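(* Let $(F,G)\in\mathbb R^{n\times n}\times\mathbb R^{n\times m}$ be a controllable pair with controllability indices $k_1\ge\cdots\ge k_m$, and let $\alpha_1(s)\mid\cdots\mid\alpha_n(s)$ be monic real polynomials satisfying $$(k_1,\dots,k_m)\prec(\deg\alpha_n(s),\deg\alpha_{n-1}(s),\dots,\deg\alpha_1(s)).$$ Then the set $$\mathcal H_{(F,G)}=\{K\in\mathbb R^{m\times n}:\ F+GK\in\mathcal O(\underline\alpha)\}$$ is a submanifold of $\mathbb R^{m\times n}$ and $\dim\mathcal H_{(F,G)}=nm-N$, where $$N=\sum_{k=1}^n(2k-1)\deg(\alpha_{n-k+1}(s)).$$
   Context: $(F,G)$ is controllable if $\operatorname{rank}[G\ FG\ \cdots\ F^{n-1}G]=n$. The Brunovsky indices $r_1\ge r_2\ge\cdots\ge r_n\ge0$ of a controllable pair are defined by $r_1+\cdots+r_i=\operatorname{rank}[G\ FG\ \cdots\ F^{i-1}G]$, $1\le i\le n$, and its controllability indices are $k_i=\#\{j: r_j\ge i\}$, $1\le i\le m$. $\mathcal O(\underline\alpha)\subset\mathbb R^{n\times n}$ is the set of all real $n\times n$ matrices whose invariant polynomials are $\alpha_1(s)\mid\cdots\mid\alpha_n(s)$ (a similarity class). For finite nonincreasing sequences of nonnegative integers $a=(a_1,\dots,a_l)$, $b=(b_1,\dots,b_l)$ (padded with zeros to the same length), $a\prec b$ means $\sum_{i\le j}a_i\le\sum_{i\le j}b_i$ for all $j$, and $\sum_i a_i=\sum_i b_i$. Submanifold means (immersed) differentiable submanifold.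 *)

theory Defs
  imports "HOL-Analysis.Analysis" "HOL-Computational_Algebra.Polynomial"
begin

text \<open>Throughout, \<open>n = CARD('n)\<close> and \<open>m = CARD('m)\<close>, and \<open>F\<close> is \<open>n \<times> n\<close>, \<open>G\<close> is \<open>n \<times> m\<close>.
  Sequences such as the invariant polynomials are indexed from \<open>1\<close>.\<close>

text \<open>The rank of the block matrix \<open>[G  FG  \<dots>  F^(i-1) G]\<close>: its number of columns depends on \<open>i\<close>,
  so its rank is written as the dimension of the span of the columns of its blocks.\<close>

definition ctrb_rank :: "real^'n^'n \<Rightarrow> real^'m^'n \<Rightarrow> nat \<Rightarrow> nat" where
  "ctrb_rank F G i = dim (\<Union>j<i. columns ((((**) F) ^^ j) G))"

definition controllable :: "real^'n^'n \<Rightarrow> real^'m^'n \<Rightarrow> bool" where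
  "controllable F G \<longleftrightarrow> ctrb_rank F G CARD('n) = CARD('n)"

text \<open>The solution of \<open>r_1 + \<dots> + r_i = ctrb_rank F G i\<close>. The subtraction does not truncate, since
  \<open>ctrb_rank F G\<close> is monotone, and \<open>ctrb_rank F G 0 = 0\<close>.\<close>

definition brunovsky_index :: "real^'n^'n \<Rightarrow> real^'m^'n \<Rightarrow> nat \<Rightarrow> nat" where
  "brunovsky_index F G i = ctrb_rank F G i - ctrb_rank F G (i - 1)"

definition ctrb_index :: "real^'n^'n \<Rightarrow> real^'m^'n \<Rightarrow> nat \<Rightarrow> nat" where
  "ctrb_index F G i = card {j \<in> {1..CARD('n)}. brunovsky_index F G j \<ge> i}"

text \<open>Since \<open>take j a = a\<close> for \<open>j \<ge> length a\<close>, the partial sums are those of the zero-padded lists.\<close>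

definition majorized :: "nat list \<Rightarrow> nat list \<Rightarrow> bool" where
  "majorized a b \<longleftrightarrow>
     (\<forall>j. sum_list (take j a) \<le> sum_list (take j b)) \<and> sum_list a = sum_list b"

definition char_matrix :: "real^'n^'n \<Rightarrow> (real poly)^'n^'n" where
  "char_matrix A = mat [:0, 1:] - (\<chi> i j. [:A $ i $ j:])"

text \<open>The invariant polynomials are the diagonal of the Smith normal form of \<open>sI - A\<close>.
  The index type \<open>'n\<close> carries no order, so the diagonal positions are numbered by a bijection \<open>e\<close>;
  its choice is immaterial because permutation matrices are unimodular.\<close>

definition has_invariant_polynomials :: "real^'n^'n \<Rightarrow> (nat \<Rightarrow> real poly) \<Rightarrow> bool" where
  "has_invariant_polynomials A \<alpha> \<longleftrightarrow>
     (\<forall>i\<in>{1..CARD('n)}. lead_coeff (\<alpha> i) = 1) \<and>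
     (\<forall>i\<in>{1..<CARD('n)}. \<alpha> i dvd \<alpha> (Suc i)) \<and>
     (\<exists>(U :: (real poly)^'n^'n) (V :: (real poly)^'n^'n) (e :: 'n \<Rightarrow> nat).
        invertible U \<and> invertible V \<and> bij_betw e UNIV {1..CARD('n)} \<and>
        U ** char_matrix A ** V = (\<chi> i j. if i = j then \<alpha> (e i) else 0))"

definition similarity_class :: "(nat \<Rightarrow> real poly) \<Rightarrow> (real^'n^'n) set" where
  "similarity_class \<alpha> = {A. has_invariant_polynomials A \<alpha>}"

definition feedback_set :: "real^'n^'n \<Rightarrow> real^'m^'n \<Rightarrow> (nat \<Rightarrow> real poly) \<Rightarrow> (real^'n^'m) set" where
  "feedback_set F G \<alpha> = {K. F + G ** K \<in> similarity_class \<alpha>}"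

primrec Ck_on :: "nat \<Rightarrow> ('a::euclidean_space \<Rightarrow> 'b::euclidean_space) \<Rightarrow> 'a set \<Rightarrow> bool" where
  "Ck_on 0 f W \<longleftrightarrow> continuous_on W f"
| "Ck_on (Suc k) f W \<longleftrightarrow>
     (\<forall>x\<in>W. f differentiable (at x)) \<and>
     (\<forall>v. Ck_on k (\<lambda>x. frechet_derivative f (at x) v) W)"

definition smooth_on :: "('a::euclidean_space \<Rightarrow> 'b::euclidean_space) \<Rightarrow> 'a set \<Rightarrow> bool" where
  "smooth_on f W \<longleftrightarrow> open W \<and> (\<forall>k. Ck_on k f W)"

text \<open>A \<open>d\<close>-dimensional immersed submanifold \<open>S\<close> of a Euclidean space: \<open>S\<close> carries a Hausdorff,
  second countable topology \<open>T\<close>, possibly finer than the subspace topology, and is covered by the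
  \<open>T\<close>-open images of local parametrizations that are homeomorphisms for \<open>T\<close> and smooth immersions
  into the ambient space. As a type cannot depend on \<open>d\<close>, the model space \<open>R^d\<close> is a \<open>d\<close>-dimensional
  linear subspace \<open>L\<close> of the ambient space (so \<open>d = 0\<close> is allowed), and the domain of a
  parametrization is \<open>W \<inter> L\<close> with \<open>W\<close> open. Taking \<open>\<phi>\<close> smooth on all of \<open>W\<close> is no restriction:
  replace \<open>\<phi>\<close> by its composition with the orthogonal projection onto \<open>L\<close>. Smoothness of the
  transition maps need not be required, as it follows from the immersion property.\<close>

definition immersed_submanifold :: "nat \<Rightarrow> 'a::euclidean_space set \<Rightarrow> bool" where
  "immersed_submanifold d S \<longleftrightarrow>
     (\<exists>T. topspace T = S \<and> Hausdorff_space T \<and> second_countable T \<and>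
          continuous_map T euclidean (\<lambda>x. x) \<and>
          (\<forall>p\<in>S. \<exists>L W (\<phi> :: 'a \<Rightarrow> 'a).
             subspace L \<and> dim L = d \<and> smooth_on \<phi> W \<and>
             (\<forall>x\<in>W \<inter> L. inj_on (frechet_derivative \<phi> (at x)) L) \<and>
             openin T (\<phi> ` (W \<inter> L)) \<and> p \<in> \<phi> ` (W \<inter> L) \<and>
             homeomorphic_map (top_of_set (W \<inter> L)) (subtopology T (\<phi> ` (W \<inter> L))) \<phi>))"

end

theory Submission
  imports Defs
begin

text \<open>Existence. Operations on rows and columns turn the diagonal matrix of the invariant polynomials,
  which is column-reduced with column degrees \<open>deg \<alpha>\<^sub>i\<close>, into a column-reduced matrix with any smaller
  column degrees in the majorization order, one unit transfer at a time. Reaching the degrees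
  \<open>(k\<^sub>1, \<dots>, k\<^sub>n)\<close> and then \<open>(1, \<dots>, 1)\<close>, where the matrix is \<open>sI - A\<close>, one finds a matrix \<open>A\<close> in the
  similarity class and a subspace \<open>E\<close> such that \<open>(A, E)\<close> has the controllability indices \<open>k\<^sub>i\<close>. As the
  ranks of the reachable subspaces determine a controllable pair up to feedback equivalence, \<open>A\<close> is
  similar to some \<open>F + G K\<close>.

  Manifold structure. With \<open>A = F + G K\<^sub>0\<close> and \<open>K = K\<^sub>0 + Y (I + X)\<^sup>-\<^sup>1\<close>, the condition
  \<open>(F + G K) (I + X) = (I + X) A\<close> is linear in \<open>(X, Y)\<close>, which yields a rational parametrization of the
  feedback set near \<open>K\<^sub>0\<close>. Its dimension follows from transversality, a consequence of
  controllability, and from Frobenius' formula for the dimension of the centralizer of \<open>A\<close>.\<close>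

section \<open>Reachable subspaces and feedback equivalence\<close>

text \<open>A polynomial matrix equivalent to sI - A presents the space on which s acts as A, with
  the columns of the matrix as relations. Equivalence keeps the invariant polynomials, while the
  column degrees of a column-reduced form are the lengths of the chains grown from its generators.
  Hence the two stops: the matrix with degrees k supplies the generators spanning E, and the one
  with degrees 1 is literally sI - A, so both describe a single A. The obstacle in the second half
  is a continuous inverse of the parametrization. Every K in the feedback set admits an invertible
  intertwiner between A and F + G K, but such intertwiners are far from unique and must be chosen
  continuously in K. Fixing a right inverse \<sigma> singles one out as the solution P of an
  equation uniquely solvable for every K near \<open>K0\<close>, so P is continuous before it is
  known to intertwine anything. Frobenius' formula is therefore needed for intertwiners between two
  matrices, not only for a centralizer: equal invariant polynomials give equal dimensions, and these
  force P to intertwine.\<close>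

primrec reach :: "('a::real_vector \<Rightarrow> 'a) \<Rightarrow> 'a set \<Rightarrow> nat \<Rightarrow> 'a set" where
  "reach f E 0 = {0}"
| "reach f E (Suc i) = {x + f y |x y. x \<in> E \<and> y \<in> reach f E i}"

lemma subspace_reach:
  assumes "linear f" "subspace E"
  shows "subspace (reach f E i)"
proof (cases i)
  case 0
  then show ?thesis by (simp add: subspace_single_0)
next
  case (Suc j)
  have "subspace (reach f E (Suc k))" for k
  proof (induction k)
    case 0
    have "reach f E (Suc 0) = E" using linear_0[OF assms(1)] by auto
    then show ?case using assms by simp
  next
    case (Suc k)
    have "subspace {x + y |x y. x \<in> E \<and> y \<in> f ` reach f E (Suc k)}"
      using subspace_sums[OF assms(2) linear_subspace_image[OF assms(1) Suc]] .
    moreover have "reach f E (Suc (Suc k)) = {x + y |x y. x \<in> E \<and> y \<in> f ` reach f E (Suc k)}"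
      by (subst reach.simps) blast
    ultimately show ?case by simp
  qed
  with Suc show ?thesis by blast
qed

lemma reach_1: "linear f \<Longrightarrow> reach f E (Suc 0) = E"
  using linear_0[of f] by auto

lemma zero_in_reach: "linear f \<Longrightarrow> subspace E \<Longrightarrow> 0 \<in> reach f E i"
  using subspace_reach subspace_0 by blast

lemma reach_base: "linear f \<Longrightarrow> subspace E \<Longrightarrow> x \<in> E \<Longrightarrow> x \<in> reach f E (Suc i)"
  using zero_in_reach[of f E i] linear_0[of f] by force

lemma reach_step: "subspace E \<Longrightarrow> x \<in> reach f E i \<Longrightarrow> f x \<in> reach f E (Suc i)"
  using subspace_0[of E] by force

lemma reach_mono_Suc:
  assumes "linear f" "subspace E"
  shows "reach f E i \<subseteq> reach f E (Suc i)"
proof (induction i)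
  case 0
  show ?case using zero_in_reach[OF assms, of "Suc 0"] by (simp only: reach.simps(1)) blast
next
  case (Suc i)
  then show ?case by (subst (1 2) reach.simps) blast
qed

lemma reach_mono:
  assumes "linear f" "subspace E" "i \<le> j"
  shows "reach f E i \<subseteq> reach f E j"
  using lift_Suc_mono_le[of "reach f E", OF reach_mono_Suc[OF assms(1,2)] assms(3)] .

text \<open>\<open>reach f E i\<close> is E + f E + ... + f^(i-1) E. Feedback alters the map by a
  difference with values in E, and the summand from E absorbs it at each step.\<close>

lemma reach_perturb:
  assumes "linear f" "linear g" "subspace E" "\<And>x. f x - g x \<in> E"
  shows "reach f E i \<subseteq> reach g E i"
proof (induction i)
  case (Suc i)
  show ?case
  proof
    fix z assume "z \<in> reach f E (Suc i)"
    then obtain x y where *: "z = x + f y" "x \<in> E" "y \<in> reach f E i" by auto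
    then have "z = (x + (f y - g y)) + g y" "x + (f y - g y) \<in> E" "y \<in> reach g E i"
      using assms(4)[of y] Suc subspace_add[OF assms(3)] by auto
    then show "z \<in> reach g E (Suc i)" by (simp only: reach.simps) blast
  qed
qed simp

text \<open>The orthogonal complement of P in Q and that of the image of P in Q' have equal
  dimensions, so an isomorphism \<open>h\<close> between them can be glued to T. The result is
  linear everywhere, but injectivity is claimed on Q only.\<close>

lemma iso_extension:
  fixes T :: "'a::euclidean_space \<Rightarrow> 'a"
  assumes "linear T" "subspace P" "subspace Q" "subspace Q'" "P \<subseteq> Q"
    and "inj_on T P" "T ` P \<subseteq> Q'" "dim Q = dim Q'"
  obtains S where "linear S" "inj_on S Q" "S ` Q = Q'" "\<And>x. x \<in> P \<Longrightarrow> S x = T x"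
proof -
  define C where "C = {y \<in> Q. \<forall>x\<in>P. orthogonal x y}"
  define C' where "C' = {y \<in> Q'. \<forall>x\<in>T ` P. orthogonal x y}"
  have TP: "subspace (T ` P)" using linear_subspace_image assms by blast
  have sC: "subspace C"
    unfolding C_def subspace_def using assms(3)
    by (auto simp: orthogonal_def inner_right_distrib subspace_0 subspace_add subspace_scale)
  have sC': "subspace C'"
    unfolding C'_def subspace_def using assms(4)
    by (auto simp: orthogonal_def inner_right_distrib subspace_0 subspace_add subspace_scale)
  have "dim C + dim P = dim Q"
    unfolding C_def by (rule dim_subspace_orthogonal_to_vectors) (use assms in auto)
  moreover have "dim C' + dim (T ` P) = dim Q'"
    unfolding C'_def by (rule dim_subspace_orthogonal_to_vectors) (use assms TP in auto)
  moreover have "dim (T ` P) = dim P"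
    using dim_image_eq[OF assms(1)] assms(2,6) by (metis span_eq_iff)
  ultimately have "dim C = dim C'" using assms by simp
  then obtain h where h: "linear h" "h ` C = C'" "inj_on h C"
    using subspace_isomorphism[OF sC sC'] by blast
  \<comment> \<open>\<open>pr\<close> is the orthogonal projection onto P; its linearity comes from
    uniqueness of the decomposition.\<close>
  define pr where "pr x = (SOME p. p \<in> P \<and> x - p \<in> orthogonal_comp P)" for x
  have pr: "pr x \<in> P \<and> x - pr x \<in> orthogonal_comp P" for x
  proof -
    have "x \<in> P + orthogonal_comp P" using subspace_sum_orthogonal_comp[OF assms(2)] by simp
    then obtain p c where "x = p + c" "p \<in> P" "c \<in> orthogonal_comp P" by (auto elim: set_plus_elim)
    then have "p \<in> P \<and> x - p \<in> orthogonal_comp P" by simp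
    then show ?thesis unfolding pr_def by (rule someI)
  qed
  have pr_unique: "pr x = p" if "p \<in> P" "x - p \<in> orthogonal_comp P" for x p
  proof -
    have "(x - p) - (x - pr x) \<in> orthogonal_comp P"
      using that pr subspace_diff[OF subspace_orthogonal_comp] by blast
    then have "pr x - p \<in> P \<inter> orthogonal_comp P"
      using that pr subspace_diff[OF assms(2)] by simp
    then show ?thesis using orthogonal_Int_0[OF assms(2)] by simp
  qed
  have lpr: "linear pr"
  proof (rule linearI)
    fix x y c
    have "(x - pr x) + (y - pr y) \<in> orthogonal_comp P" 
      using pr subspace_add[OF subspace_orthogonal_comp] by blast
    then show "pr (x + y) = pr x + pr y"
      using pr by (intro pr_unique subspace_add[OF assms(2)]) (auto simp: algebra_simps)
    have "c *\<^sub>R (x - pr x) \<in> orthogonal_comp P" 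
      using pr subspace_scale[OF subspace_orthogonal_comp] by blast
    then show "pr (c *\<^sub>R x) = c *\<^sub>R pr x"
      using pr by (intro pr_unique subspace_scale[OF assms(2)]) (auto simp: algebra_simps)
  qed
  have prC: "x - pr x \<in> C" if "x \<in> Q" for x
  proof -
    have "x - pr x \<in> Q" using that pr assms(3,5) subspace_diff by blast
    then show ?thesis using pr[of x] unfolding C_def orthogonal_comp_def by auto
  qed
  define S where "S x = T (pr x) + h (x - pr x)" for x
  have lS: "linear S"
    unfolding S_def
    by (intro linear_compose_add linear_compose[unfolded o_def, OF lpr assms(1)]
        linear_compose[unfolded o_def, OF linear_compose_sub[OF linear_ident lpr] h(1)])
  have S_eq: "S x = T x" if "x \<in> P" for x
  proof -
    have "pr x = x"
      by (rule pr_unique) (use that in \<open>auto simp: subspace_0 subspace_orthogonal_comp\<close>)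
    then show ?thesis using linear_0[OF h(1)] by (simp add: S_def)
  qed
  have inj: "inj_on S Q"
    unfolding linear_inj_on_iff_eq_0[OF lS assms(3)]
  proof (intro ballI impI)
    fix x assume x: "x \<in> Q" "S x = 0"
    have hC: "h (x - pr x) \<in> C'" using prC[OF x(1)] h by blast
    have "T (pr x) = - h (x - pr x)" using x(2) unfolding S_def by (simp add: eq_neg_iff_add_eq_0)
    moreover have "T (pr x) \<bullet> h (x - pr x) = 0"
      using hC pr unfolding C'_def orthogonal_def by blast
    ultimately have "h (x - pr x) = 0" "T (pr x) = 0" by auto
    then have "x - pr x = 0" "pr x = 0"
      using h(1,3) prC[OF x(1)] sC linear_inj_on_iff_eq_0 pr assms(1,2,6) by blast+
    then show "x = 0" by simp
  qed
  have "S ` Q \<subseteq> Q'"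
  proof
    fix y assume "y \<in> S ` Q"
    then obtain x where x: "x \<in> Q" "y = S x" by auto
    have "h (x - pr x) \<in> C'" using prC[OF x(1)] h by blast
    then have "h (x - pr x) \<in> Q'" unfolding C'_def by blast
    moreover have "T (pr x) \<in> Q'" using assms pr by blast
    ultimately show "y \<in> Q'" using x assms(4) by (simp add: S_def subspace_add)
  qed
  moreover have "dim (S ` Q) = dim Q'"
    using dim_image_eq[OF lS] inj assms(3,8) by (metis span_eq_iff)
  ultimately have "S ` Q = Q'"
    using subspace_dim_equal[OF linear_subspace_image[OF lS assms(3)] assms(4)] by simp
  then show ?thesis using that lS inj S_eq by blast
qed

text \<open>Equal kernels on M make v constant on the fibres of u, hence a function of u x, and make
  that function injective. \<open>w\<close> selects a point of each fibre linearly.\<close>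

lemma linear_factor_through:
  fixes u v :: "'b::euclidean_space \<Rightarrow> 'a::euclidean_space"
  assumes "linear u" "linear v" "subspace M"
    and "\<And>x. x \<in> M \<Longrightarrow> u x = 0 \<longleftrightarrow> v x = 0"
  obtains S where "linear S" "inj_on S (u ` M)" "\<And>x. x \<in> M \<Longrightarrow> S (u x) = v x"
proof -
  obtain w where w: "range w \<subseteq> M" "linear w" "\<And>y. y \<in> u ` M \<Longrightarrow> u (w y) = y"
    using linear_exists_right_inverse_on[OF assms(1,3)] by blast
  have "v (w (u x)) = v x" if "x \<in> M" for x
  proof -
    have "w (u x) - x \<in> M" using w(1) that subspace_diff[OF assms(3)] by blast
    moreover have "u (w (u x) - x) = 0" using w(3) that by (simp add: linear_diff[OF assms(1)])
    ultimately have "v (w (u x) - x) = 0" using assms(4) by blast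
    then show ?thesis by (simp add: linear_diff[OF assms(2)])
  qed
  moreover have "linear (v \<circ> w)" using linear_compose w(2) assms(2) by blast
  moreover have "inj_on (v \<circ> w) (u ` M)"
  proof -
    have "y = 0" if "y \<in> u ` M" "v (w y) = 0" for y
      using assms(4)[of "w y"] w that by auto
    then show ?thesis
      using linear_inj_on_iff_eq_0[OF \<open>linear (v \<circ> w)\<close> linear_subspace_image[OF assms(1,3)]] by auto
  qed
  ultimately show ?thesis using that[of "v \<circ> w"] by auto
qed


text \<open>Downward induction along the flag. If S is right on \<open>Z (Suc n)\<close>, commuting
  with the maps forces its values on the sum of \<open>Z (Suc n)\<close> and its image under \<phi>,
  a subspace of \<open>Z n\<close>; on the rest of \<open>Z n\<close>, equality of dimensions
  permits any isomorphism. At N both flags are zero and the identity serves.\<close>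

lemma flag_isomorphism:
  fixes \<phi> \<psi> :: "'a::euclidean_space \<Rightarrow> 'a" and Z Z' :: "nat \<Rightarrow> 'a set"
  assumes lin: "linear \<phi>" "linear \<psi>"
    and sub: "\<And>i. subspace (Z i)" "\<And>i. subspace (Z' i)"
    and Z0: "Z 0 = UNIV" "Z' 0 = UNIV"
    and Z: "\<And>i. Z (Suc i) = {x \<in> Z 1. \<phi> x \<in> Z i}"
    and Z': "\<And>i. Z' (Suc i) = {x \<in> Z' 1. \<psi> x \<in> Z' i}"
    and ZN: "Z N = {0}"
    and dim: "\<And>i. dim (Z i) = dim (Z' i)"
  obtains S where "linear S" "inj S" "S ` Z 1 = Z' 1" "\<And>x. x \<in> Z 1 \<Longrightarrow> S (\<phi> x) = \<psi> (S x)"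
proof -
  have anti: "Z j \<subseteq> Z i" if "i \<le> j" for i j
  proof (rule lift_Suc_antimono_le[OF _ that])
    fix n show "Z (Suc n) \<subseteq> Z n"
    proof (induction n)
      case 0 show ?case by (simp add: Z0)
    next
      case (Suc n) then show ?case by (subst (1 2) Z) auto
    qed
  qed
  have anti': "Z' j \<subseteq> Z' i" if "i \<le> j" for i j
  proof (rule lift_Suc_antimono_le[OF _ that])
    fix n show "Z' (Suc n) \<subseteq> Z' n"
    proof (induction n)
      case 0 show ?case by (simp add: Z0)
    next
      case (Suc n) then show ?case by (subst (1 2) Z') auto
    qed
  qed
  have "\<exists>S. linear S \<and> inj S \<and> (\<forall>j\<ge>0. S ` Z j = Z' j) \<and> (\<forall>x\<in>Z (Suc 0). S (\<phi> x) = \<psi> (S x))"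
  proof (rule inc_induct[of 0 N "\<lambda>i. \<exists>S. linear S \<and> inj S \<and> (\<forall>j\<ge>i. S ` Z j = Z' j) \<and> (\<forall>x\<in>Z (Suc i). S (\<phi> x) = \<psi> (S x))"])
    have "Z j = {0}" if "j \<ge> N" for j
      using anti[OF that] ZN subspace_0[OF sub(1)] by auto
    moreover from this have "Z' j = {0}" if "j \<ge> N" for j
      using dim[of j] that subspace_0[OF sub(2)] by (auto simp: dim_eq_0)
    ultimately have "\<forall>j\<ge>N. id ` Z j = Z' j" "\<forall>x\<in>Z (Suc N). id (\<phi> x) = \<psi> (id x)"
      using linear_0[OF lin(1)] linear_0[OF lin(2)] by auto
    then show "\<exists>S. linear S \<and> inj S \<and> (\<forall>j\<ge>N. S ` Z j = Z' j) \<and> (\<forall>x\<in>Z (Suc N). S (\<phi> x) = \<psi> (S x))"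
      using linear_id inj_on_id by blast
  next
    fix n assume "\<exists>S. linear S \<and> inj S \<and> (\<forall>j\<ge>Suc n. S ` Z j = Z' j) \<and> (\<forall>x\<in>Z (Suc (Suc n)). S (\<phi> x) = \<psi> (S x))"
    then obtain S where S: "linear S" "inj S" "\<And>j. j \<ge> Suc n \<Longrightarrow> S ` Z j = Z' j"
      "\<And>x. x \<in> Z (Suc (Suc n)) \<Longrightarrow> S (\<phi> x) = \<psi> (S x)" by blast
    \<comment> \<open>The value at x + \<phi> y has to be S x + \<psi> (S y). \<open>u\<close> and
      \<open>v\<close> express argument and value through the pair (x, y), so that well-definedness
      becomes equality of kernels on M.\<close>
    define M where "M = Z (Suc n) \<times> Z (Suc n)"
    define u where "u p = fst p + \<phi> (snd p)" for p
    define v where "v p = S (fst p) + \<psi> (S (snd p))" for p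
    have lu: "linear u" unfolding u_def using lin
      by (intro linear_compose_add linear_fst linear_compose[unfolded o_def, OF linear_snd])
    have lv: "linear v" unfolding v_def using lin S(1)
      by (intro linear_compose_add linear_compose[unfolded o_def, OF linear_fst]
          linear_compose[unfolded o_def, OF linear_compose[unfolded o_def, OF linear_snd]])
    have sM: "subspace M" unfolding M_def using sub by (simp add: subspace_Times)
    \<comment> \<open>In either kernel, y already lies in the next smaller space, where S is known
      to commute with the maps and so \<open>v p = S (u p)\<close>.\<close>
    have "u p = 0 \<longleftrightarrow> v p = 0" if pM: "p \<in> M" for p
    proof -
      obtain x y where p: "p = (x, y)" "x \<in> Z (Suc n)" "y \<in> Z (Suc n)"
        using pM unfolding M_def by (rule SigmaE)
      have "v p = S (u p)" if "y \<in> Z (Suc (Suc n))"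
        using S(4)[OF that] by (simp add: u_def v_def p linear_add[OF S(1)])
      moreover have "y \<in> Z (Suc (Suc n))" if "u p = 0"
      proof -
        have "\<phi> y = - x" using that unfolding u_def p by (simp add: eq_neg_iff_add_eq_0 add.commute)
        then have "\<phi> y \<in> Z (Suc n)" using p subspace_neg[OF sub(1)] by simp
        then show ?thesis using p(3) anti[of 1 "Suc n"] by (subst Z) auto
      qed
      moreover have "y \<in> Z (Suc (Suc n))" if "v p = 0"
      proof -
        have Sx: "S x \<in> Z' (Suc n)" "S y \<in> Z' (Suc n)" using S(3)[of "Suc n"] p by auto
        have "\<psi> (S y) = - S x" using that unfolding v_def p by (simp add: eq_neg_iff_add_eq_0 add.commute)
        then have "\<psi> (S y) \<in> Z' (Suc n)" using Sx subspace_neg[OF sub(2)] by simp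
        then have "S y \<in> Z' (Suc (Suc n))" using Sx(2) anti'[of 1 "Suc n"] by (subst Z') auto
        then have "S y \<in> S ` Z (Suc (Suc n))" using S(3) by simp
        then show ?thesis using S(2) by (simp add: inj_image_mem_iff)
      qed
      ultimately show ?thesis using linear_injective_0[OF S(1)] S(2) linear_0[OF S(1)] by metis
    qed
    then obtain S0 where S0: "linear S0" "inj_on S0 (u ` M)" "\<And>p. p \<in> M \<Longrightarrow> S0 (u p) = v p"
      using linear_factor_through[OF lu lv sM] by metis
    have uM: "u ` M \<subseteq> Z n"
    proof -
      have "x + \<phi> y \<in> Z n" if "x \<in> Z (Suc n)" "y \<in> Z (Suc n)" for x y
        using that anti[of n "Suc n"] Z[of n] subspace_add[OF sub(1)] by auto
      then show ?thesis by (auto simp: u_def M_def)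
    qed
    have vM: "S0 ` u ` M \<subseteq> Z' n"
    proof -
      have "S x + \<psi> (S y) \<in> Z' n" if "x \<in> Z (Suc n)" "y \<in> Z (Suc n)" for x y
      proof -
        have "S x \<in> Z' (Suc n)" "S y \<in> Z' (Suc n)" using S(3)[of "Suc n"] that by auto
        then show ?thesis using anti'[of n "Suc n"] Z'[of n] subspace_add[OF sub(2)] by auto
      qed
      then show ?thesis using S0(3) by (auto simp: v_def M_def)
    qed
    obtain S1 where S1: "linear S1" "inj_on S1 (Z n)" "S1 ` Z n = Z' n" "\<And>x. x \<in> u ` M \<Longrightarrow> S1 x = S0 x"
      using iso_extension[OF S0(1) linear_subspace_image[OF lu sM] sub(1) sub(2) uM S0(2) vM dim] by metis
    \<comment> \<open>\<open>S1\<close> is injective on \<open>Z n\<close> only, while the induction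
      carries a globally injective map; hence a second extension.\<close>
    obtain S2 where S2: "linear S2" "inj_on S2 UNIV" "\<And>x. x \<in> Z n \<Longrightarrow> S2 x = S1 x"
      using iso_extension[OF S1(1) sub(1) subspace_UNIV subspace_UNIV _ S1(2) _ refl] by (metis subset_UNIV)
    have S2u: "S2 (u p) = v p" if "p \<in> M" for p
      using S2(3)[of "u p"] S1(4)[of "u p"] S0(3) uM that by auto
    have S2S: "S2 x = S x" if "x \<in> Z (Suc n)" for x
      using S2u[of "(x, 0)"] that subspace_0[OF sub(1)]
      by (simp add: u_def v_def M_def linear_0[OF lin(1)] linear_0[OF lin(2)] linear_0[OF S(1)])
    have "S2 ` Z j = Z' j" if "j \<ge> n" for j
    proof (cases "j = n")
      case True then show ?thesis using S2(3) S1(3) by (metis image_cong)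
    next
      case False
      then have j: "j \<ge> Suc n" using that by simp
      then have "S2 ` Z j = S ` Z j" using S2S anti[OF j] by (intro image_cong) auto
      then show ?thesis using S(3) j by simp
    qed
    moreover have "S2 (\<phi> y) = \<psi> (S2 y)" if "y \<in> Z (Suc n)" for y
      using S2u[of "(0, y)"] that subspace_0[OF sub(1)] S2S
      by (simp add: u_def v_def M_def linear_0[OF S(1)])
    ultimately show "\<exists>S. linear S \<and> inj S \<and> (\<forall>j\<ge>n. S ` Z j = Z' j) \<and> (\<forall>x\<in>Z (Suc n). S (\<phi> x) = \<psi> (S x))"
      using S2(1,2) by blast
  qed simp
  then show ?thesis using that by auto
qed

text \<open>Annihilators turn the sum of E and the image under f into an intersection, and f into
  its adjoint. This is the recursion that \<open>flag_isomorphism\<close> requires.\<close>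

lemma orthogonal_comp_reach_Suc:
  fixes f :: "'a::euclidean_space \<Rightarrow> 'a"
  assumes "linear f" "subspace E"
  shows "orthogonal_comp (reach f E (Suc i)) =
    {x \<in> orthogonal_comp (reach f E 1). adjoint f x \<in> orthogonal_comp (reach f E i)}" (is "?l = ?r")
proof
  have E: "reach f E 1 = E" using reach_1[OF assms(1)] by simp
  show "?l \<subseteq> ?r"
  proof
    fix x assume x: "x \<in> ?l"
    have "y \<bullet> x = 0" if "y \<in> E" for y
      using x reach_base[OF assms that] by (auto simp: orthogonal_comp_def orthogonal_def)
    moreover have "y \<bullet> adjoint f x = 0" if "y \<in> reach f E i" for y
      using x reach_step[OF assms(2) that] adjoint_works[OF assms(1)]
      by (auto simp: orthogonal_comp_def orthogonal_def simp del: reach.simps)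
    ultimately show "x \<in> ?r" unfolding E by (auto simp: orthogonal_comp_def orthogonal_def)
  qed
  show "?r \<subseteq> ?l"
    unfolding E by (auto simp: orthogonal_comp_def orthogonal_def inner_add_left adjoint_works[OF assms(1), symmetric])
qed

lemma dim_orthogonal_comp:
  fixes W :: "'a::euclidean_space set"
  assumes "subspace W"
  shows "dim (orthogonal_comp W) = DIM('a) - dim W"
  using dim_subspace_orthogonal_to_vectors[OF assms subspace_UNIV] unfolding orthogonal_comp_def by simp

text \<open>The isomorphism is built on the annihilators of the reachable subspaces, from the smallest one
  upwards, because a map is easier to extend from a subspace than to lift from a quotient.\<close>

theorem feedback_equivalence:
  fixes f g :: "'a::euclidean_space \<Rightarrow> 'a"
  assumes lin: "linear f" "linear g" and sub: "subspace E" "subspace E'"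
    and dim: "\<And>i. dim (reach f E i) = dim (reach g E' i)"
    and full: "reach f E N = UNIV"
  obtains T T' where "linear T" "linear T'" "\<And>x. T' (T x) = x" "\<And>x. T (T' x) = x"
    "\<And>x. T' (g (T x)) - f x \<in> E"
proof -
  define Z where "Z i = orthogonal_comp (reach g E' i)" for i
  define Z' where "Z' i = orthogonal_comp (reach f E i)" for i
  have full': "reach g E' N = UNIV"
    using dim[of N] full subspace_reach[OF lin(2) sub(2)]
    by (metis dim_UNIV dim_eq_full span_eq_iff)
  \<comment> \<open>The flag of g is the source and that of f the target, because passing to the
    adjoint reverses the direction of S.\<close>
  obtain S where S: "linear S" "inj S" "S ` Z 1 = Z' 1"
    "\<And>x. x \<in> Z 1 \<Longrightarrow> S (adjoint g x) = adjoint f (S x)"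
  proof (rule flag_isomorphism[of "adjoint g" "adjoint f" Z Z' N])
    show "dim (Z i) = dim (Z' i)" for i
      using dim_orthogonal_comp[OF subspace_reach[OF lin(2) sub(2)]]
        dim_orthogonal_comp[OF subspace_reach[OF lin(1) sub(1)]] dim by (simp add: Z_def Z'_def)
    show "Z (Suc i) = {x \<in> Z 1. adjoint g x \<in> Z i}" for i
      using orthogonal_comp_reach_Suc[OF lin(2) sub(2)] by (simp add: Z_def)
    show "Z' (Suc i) = {x \<in> Z' 1. adjoint f x \<in> Z' i}" for i
      using orthogonal_comp_reach_Suc[OF lin(1) sub(1)] by (simp add: Z'_def)
  qed (use lin full' in \<open>auto simp: Z_def Z'_def subspace_orthogonal_comp adjoint_linear\<close>)
  define T where "T = adjoint S"
  have T: "linear T" unfolding T_def by (rule adjoint_linear[OF S(1)])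
  have ST: "x \<bullet> T y = S x \<bullet> y" for x y unfolding T_def by (rule adjoint_works[OF S(1)])
  have "inj T"
    unfolding linear_injective_0[OF T]
  proof (intro allI impI)
    fix x assume "T x = 0"
    then have "S y \<bullet> x = 0" for y using ST[of y x] by simp
    moreover have "surj S" using linear_inj_imp_surj[OF S(1,2)] .
    ultimately have "x \<bullet> x = 0" by (metis surjD)
    then show "x = 0" by simp
  qed
  then obtain T' where T': "linear T'" "\<And>x. T' (T x) = x" "\<And>x. T (T' x) = x"
    using linear_injective_isomorphism[OF T] by blast
  have E: "E = orthogonal_comp (Z' 1)" "E' = orthogonal_comp (Z 1)"
    unfolding Z_def Z'_def One_nat_def reach_1[OF lin(1)] reach_1[OF lin(2)]
    using orthogonal_comp_self[OF sub(1)] orthogonal_comp_self[OF sub(2)] by simp_all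
  \<comment> \<open>E is the annihilator of \<open>Z' 1\<close>, so membership is tested against the
    vectors there, each of which is S \<xi> for some \<xi> in \<open>Z 1\<close>.\<close>
  have "T' (g (T x)) - f x \<in> E" for x
    unfolding E orthogonal_comp_def orthogonal_def
  proof clarify
    fix \<zeta> assume "\<zeta> \<in> Z' 1"
    then obtain \<xi> where \<xi>: "\<xi> \<in> Z 1" "\<zeta> = S \<xi>" using S(3) by blast
    have "\<zeta> \<bullet> T' (g (T x)) = \<xi> \<bullet> g (T x)" using ST \<xi> T' by metis
    also have "\<dots> = S (adjoint g \<xi>) \<bullet> x" using adjoint_clauses(2)[OF lin(2)] ST by metis
    also have "\<dots> = \<zeta> \<bullet> f x" using S(4) \<xi> adjoint_clauses(2)[OF lin(1)] by simp
    finally show "\<zeta> \<bullet> (T' (g (T x)) - f x) = 0" by (simp add: inner_diff_right)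
  qed
  then show ?thesis using that T T' by blast
qed

section \<open>Growth of the dimensions of reachable subspaces\<close>

lemma card_filter_sum: "finite A \<Longrightarrow> card {x \<in> A. P x} = (\<Sum>x\<in>A. of_bool (P x))"
  by (simp add: sum_of_bool_eq Int_def)

lemma dim_Un_le_card:
  fixes A :: "'a::euclidean_space set"
  assumes "finite B"
  shows "dim (A \<union> B) \<le> dim A + card B"
  using assms by (induction B) (auto simp: dim_insert)

text \<open>f maps a complement \<open>C\<close> of R(i) in R(i+1) onto R(i+2) modulo R(i+1), so the
  increments of the dimension cannot grow.\<close>

lemma reach_concave:
  fixes f :: "'a::euclidean_space \<Rightarrow> 'a"
  assumes "linear f" "subspace E"
  shows "dim (reach f E (Suc (Suc i))) + dim (reach f E i) \<le> 2 * dim (reach f E (Suc i))"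
proof -
  let ?R = "reach f E"
  have sR: "subspace (?R i)" for i using subspace_reach[OF assms] .
  define C where "C = {y \<in> ?R (Suc i). \<forall>x\<in>?R i. orthogonal x y}"
  have dC: "dim C + dim (?R i) = dim (?R (Suc i))"
    unfolding C_def by (rule dim_subspace_orthogonal_to_vectors) (use sR reach_mono_Suc[OF assms] in blast)+
  obtain B where B: "B \<subseteq> C" "independent B" "C \<subseteq> span B" "card B = dim C" using basis_exists .
  have "finite B" using B(2) independent_imp_finite by blast
  have *: "?R (Suc (Suc i)) \<subseteq> span (?R (Suc i) \<union> f ` B)"
  proof
    fix z assume "z \<in> ?R (Suc (Suc i))"
    then obtain x y where z: "z = x + f y" "x \<in> E" "y \<in> ?R (Suc i)" by (subst (asm) reach.simps) blast
    obtain p q where y: "y = p + q" "p \<in> span (?R i)" "\<And>w. w \<in> span (?R i) \<Longrightarrow> orthogonal q w"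
      using orthogonal_subspace_decomp_exists[of "?R i" y] by metis
    have p: "p \<in> ?R i" using y(2) sR span_eq_iff by blast
    then have "q \<in> ?R (Suc i)" using y(1) z(3) reach_mono_Suc[OF assms] subspace_diff[OF sR]
      by (metis add_diff_cancel_left' subsetD)
    then have "q \<in> C" unfolding C_def using y(3) span_base orthogonal_commute by blast
    then have "f q \<in> span (f ` B)" using B(3) linear_span_image[OF assms(1)] by blast
    then have "f q \<in> span (?R (Suc i) \<union> f ` B)" by (rule subsetD[OF span_mono, rotated]) blast
    moreover have "x + f p \<in> span (?R (Suc i) \<union> f ` B)" using z(2) p by (intro span_base) auto
    ultimately have "(x + f p) + f q \<in> span (?R (Suc i) \<union> f ` B)" by (rule span_add[rotated])
    then show "z \<in> span (?R (Suc i) \<union> f ` B)" using z y by (simp add: linear_add[OF assms(1)] add.assoc)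
  qed
  have "dim (?R (Suc (Suc i))) \<le> dim (?R (Suc i) \<union> f ` B)" using dim_mono[OF *] .
  also have "\<dots> \<le> dim (?R (Suc i)) + card (f ` B)" using dim_Un_le_card \<open>finite B\<close> by blast
  also have "\<dots> \<le> dim (?R (Suc i)) + dim C" using card_image_le[OF \<open>finite B\<close>] B(4) by simp
  finally show ?thesis using dC by simp
qed

text \<open>Step i adds at most one dimension for each chain longer than i, since the other chains
  have already fallen into earlier reachable spaces. Over all i these bounds add up to at most the
  sum of the k l, which is the full dimension; as everything is reached, none of them is
  strict.\<close>

lemma dim_reach_chain:
  fixes f :: "'a::euclidean_space \<Rightarrow> 'a" and h :: "'i::finite \<Rightarrow> 'a"
  assumes lin: "linear f" and E: "E = span (range h)"
    and chain: "\<And>l. (f ^^ k l) (h l) \<in> reach f E (k l)"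
    and full: "reach f E N = UNIV" and sum: "(\<Sum>l\<in>UNIV. k l) = DIM('a)"
  shows "dim (reach f E i) = (\<Sum>j<i. card {l. k l > j})"
proof -
  let ?R = "reach f E"
  have sE: "subspace E" unfolding E by simp
  have pow_in: "(f ^^ j) x \<in> ?R (i + j)" if "x \<in> ?R i" for i j x
    using that by (induction j) (auto intro: reach_step[OF sE] simp del: reach.simps)
  have *: "?R (Suc i) \<subseteq> span (?R i \<union> range (\<lambda>l. (f ^^ i) (h l)))" for i
  proof (induction i)
    case 0
    show ?case unfolding reach_1[OF lin] using E span_mono[of "range h"] by auto
  next
    case (Suc i)
    let ?S = "?R (Suc i) \<union> range (\<lambda>l. (f ^^ Suc i) (h l))"
    show ?case
    proof
      fix z assume "z \<in> ?R (Suc (Suc i))"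
      then obtain x y where z: "z = x + f y" "x \<in> E" "y \<in> ?R (Suc i)" by (subst (asm) reach.simps) blast
      have "f y \<in> span (f ` (?R i \<union> range (\<lambda>l. (f ^^ i) (h l))))"
        using Suc z(3) linear_span_image[OF lin] by blast
      moreover have "f ` (?R i \<union> range (\<lambda>l. (f ^^ i) (h l))) \<subseteq> ?S"
        using reach_step[OF sE] by (auto simp: image_iff simp del: reach.simps)
      ultimately have "f y \<in> span ?S" using span_mono by blast
      moreover have "x \<in> span ?S" using z(2) reach_base[OF lin sE] by (intro span_base) blast
      ultimately show "z \<in> span ?S" using z span_add by blast
    qed
  qed
  have step: "dim (?R (Suc i)) \<le> dim (?R i) + card {l. k l > i}" for i
  proof -
    have "(f ^^ i) (h l) \<in> ?R i" if "k l \<le> i" for l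
    proof -
      have "(f ^^ i) (h l) = (f ^^ (i - k l)) ((f ^^ k l) (h l))"
        using that funpow_add[of "i - k l" "k l" f] by simp
      then show ?thesis using pow_in[OF chain[of l], of "i - k l"] that by simp
    qed
    then have "(f ^^ i) (h l) \<in> ?R i \<union> (\<lambda>l. (f ^^ i) (h l)) ` {l. k l > i}" for l
      by (cases "k l \<le> i") simp_all
    then have "range (\<lambda>l. (f ^^ i) (h l)) \<subseteq> ?R i \<union> (\<lambda>l. (f ^^ i) (h l)) ` {l. k l > i}"
      by blast
    then have "?R (Suc i) \<subseteq> span (?R i \<union> (\<lambda>l. (f ^^ i) (h l)) ` {l. k l > i})"
      using * [of i] span_mono[of "?R i \<union> range (\<lambda>l. (f ^^ i) (h l))" "?R i \<union> (\<lambda>l. (f ^^ i) (h l)) ` {l. k l > i}"]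
      by blast
    then have "dim (?R (Suc i)) \<le> dim (?R i \<union> (\<lambda>l. (f ^^ i) (h l)) ` {l. k l > i})" by (rule dim_mono)
    also have "\<dots> \<le> dim (?R i) + card ((\<lambda>l. (f ^^ i) (h l)) ` {l. k l > i})" by (rule dim_Un_le_card) simp
    also have "\<dots> \<le> dim (?R i) + card {l. k l > i}" using card_image_le[of "{l. k l > i}"] by simp
    finally show ?thesis .
  qed
  have up: "dim (?R (i + j)) \<le> dim (?R i) + (\<Sum>t<j. card {l. k l > i + t})" for i j
  proof (induction j)
    case (Suc j) then show ?case using step[of "i + j"] by simp
  qed simp
  \<comment> \<open>Double counting: the chain l is counted once for each j < k l.\<close>
  have tot: "(\<Sum>j<M. card {l. k l > j}) \<le> DIM('a)" for M
  proof -
    have "(\<Sum>j<M. card {l. k l > j}) = (\<Sum>j<M. \<Sum>l\<in>UNIV. of_bool (k l > j))"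
      using card_filter_sum[of UNIV] by simp
    also have "\<dots> = (\<Sum>l\<in>UNIV. \<Sum>j<M. of_bool (k l > j))" by (rule sum.swap)
    also have "\<dots> \<le> (\<Sum>l\<in>UNIV. k l)"
    proof (rule sum_mono)
      fix l
      have "(\<Sum>j<M. of_bool (k l > j)) = card {j \<in> {..<M}. k l > j}"
        using card_filter_sum[of "{..<M}"] by simp
      also have "\<dots> \<le> card {..<k l}" by (rule card_mono) auto
      finally show "(\<Sum>j<M. of_bool (k l > j)) \<le> k l" by simp
    qed
    finally show ?thesis using sum by simp
  qed
  have "dim (?R (i + N)) = DIM('a)"
    using full reach_mono[OF lin sE, of N "i + N"] by (metis dim_UNIV le_add2 top.extremum_uniqueI)
  then have "DIM('a) \<le> dim (?R i) + (\<Sum>t<N. card {l. k l > i + t})" using up[of i N] by simp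
  moreover have "(\<Sum>j<i+N. card {l. k l > j}) = (\<Sum>j<i. card {l. k l > j}) + (\<Sum>t<N. card {l. k l > i + t})"
    by (induction N) auto
  moreover have "dim (?R i) \<le> (\<Sum>j<i. card {l. k l > j})" using up[of 0 i] by simp
  ultimately show ?thesis using tot[of "i + N"] by linarith
qed

section \<open>Column-reduced polynomial matrices\<close>

text \<open>Majorization is generated by moving single units from a larger entry to a smaller one.
  The intermediate sequences need not be sorted; only the target k is.\<close>

lemma transfer_reachable:
  fixes d k :: "nat \<Rightarrow> nat"
  assumes step: "\<And>x p q. P x \<Longrightarrow> p \<in> {1..n} \<Longrightarrow> q \<in> {1..n} \<Longrightarrow> x p \<ge> x q + 2
      \<Longrightarrow> P (x(p := x p - 1, q := x q + 1))"
    and anti: "\<And>i j. 1 \<le> i \<Longrightarrow> i \<le> j \<Longrightarrow> j \<le> n \<Longrightarrow> k j \<le> k i"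
    and le: "\<And>j. j \<le> n \<Longrightarrow> (\<Sum>i=1..j. k i) \<le> (\<Sum>i=1..j. d i)"
    and eq: "(\<Sum>i=1..n. k i) = (\<Sum>i=1..n. d i)"
    and P: "P d"
  obtains x where "P x" "\<And>i. i \<in> {1..n} \<Longrightarrow> x i = k i"
proof -
  have "\<exists>x. P x \<and> (\<forall>i\<in>{1..n}. x i = k i)"
    using P le eq
  \<comment> \<open>The measure is the total excess over k: truncated subtraction ignores the
    entries lying below k.\<close>
  proof (induction "\<Sum>i=1..n. d i - k i" arbitrary: d rule: less_induct)
    case less
    note le = less.prems(2) and eq = less.prems(3)
    show ?case
    proof (cases "\<exists>q\<in>{1..n}. d q < k q")
      case False
      have "d i = k i" if "i \<in> {1..n}" for i
      proof (rule ccontr)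
        assume "d i \<noteq> k i"
        then have "(\<Sum>i=1..n. k i) < (\<Sum>i=1..n. d i)"
          using False that by (intro sum_strict_mono_ex1) (auto simp: not_less le_neq_implies_less intro!: bexI[of _ i])
        then show False using eq by simp
      qed
      then show ?thesis using less.prems(1) by blast
    next
      case True
      \<comment> \<open>With q least, every earlier entry is at least the corresponding k i. From p
        up to q - 1 the partial sums then strictly exceed those of k, so a unit can be removed there
        without breaking the inequalities.\<close>
      define q where "q = (LEAST q. q \<in> {1..n} \<and> d q < k q)"
      have q: "q \<in> {1..n}" "d q < k q"
        using LeastI_ex[of "\<lambda>q. q \<in> {1..n} \<and> d q < k q"] True unfolding q_def by blast+
      have less_q: "k i \<le> d i" if "1 \<le> i" "i < q" for i
        using not_less_Least[of i "\<lambda>q. q \<in> {1..n} \<and> d q < k q"] that q unfolding q_def[symmetric] by auto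
      have "\<exists>p\<in>{1..<q}. d p > k p"
      proof (rule ccontr)
        assume "\<not> ?thesis"
        then have "(\<Sum>i=1..<q. d i) \<le> (\<Sum>i=1..<q. k i)" by (intro sum_mono) (auto simp: not_less)
        then have "(\<Sum>i=1..q. d i) < (\<Sum>i=1..q. k i)"
          using q by (simp add: atLeastLessThanSuc_atLeastAtMost[symmetric])
        then show False using le[of q] q by simp
      qed
      then obtain p where p: "1 \<le> p" "p < q" "d p > k p" by auto
      \<comment> \<open>Because d p > k p \<ge> k q > d q.\<close>
      have pq: "d p \<ge> d q + 2" using anti[of p q] p q by auto
      define d' where "d' = d(p := d p - 1, q := d q + 1)"
      have sum': "(\<Sum>i=1..j. d' i) + of_bool (p \<le> j) = (\<Sum>i=1..j. d i) + of_bool (q \<le> j)" for j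
      proof -
        have "(\<Sum>i=1..j. d' i + of_bool (i = p)) = (\<Sum>i=1..j. d i + of_bool (i = q))"
          using p(2,3) by (intro sum.cong) (auto simp: d'_def)
        moreover have "(\<Sum>i=1..j. of_bool (i = t) :: nat) = of_bool (t \<le> j)" if "1 \<le> t" for t
        proof (cases "t \<le> j")
          case True
          then have "{1..j} \<inter> {i. i = t} = {t}" using that by auto
          then show ?thesis using True by simp
        next
          case False
          then have "{1..j} \<inter> {i. i = t} = {}" by auto
          then show ?thesis using False by simp
        qed
        ultimately show ?thesis using p(1,2) by (simp add: sum.distrib del: sum_of_bool_eq)
      qed
      have "P d'" unfolding d'_def using less.prems(1) p q pq by (intro step) auto
      moreover have "(\<Sum>i=1..j. k i) \<le> (\<Sum>i=1..j. d' i)" if "j \<le> n" for j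
      proof (cases "p \<le> j \<and> j < q")
        case False
        then show ?thesis using sum'[of j] le[OF that] p(2) by (cases "p \<le> j") auto
      next
        case True
        have "(\<Sum>i=1..j. k i) < (\<Sum>i=1..j. d i)"
          using True less_q p by (intro sum_strict_mono_ex1) (auto intro!: bexI[of _ p])
        then show ?thesis using sum'[of j] True by simp
      qed
      moreover have "(\<Sum>i=1..n. k i) = (\<Sum>i=1..n. d' i)" using sum'[of n] p q eq by simp
      moreover have "(\<Sum>i=1..n. d' i - k i) < (\<Sum>i=1..n. d i - k i)"
        using p q by (intro sum_strict_mono_ex1) (auto simp: d'_def intro!: bexI[of _ p])
      ultimately show ?thesis using less.hyps by blast
    qed
  qed
  then show ?thesis using that by blast
qed

section \<open>Unimodular equivalence and elementary operations\<close>

definition unimod_equiv :: "('a::comm_ring_1)^'n^'n \<Rightarrow> 'a^'n^'n \<Rightarrow> bool" where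
  "unimod_equiv D D' \<longleftrightarrow> (\<exists>U V. invertible U \<and> invertible V \<and> U ** D ** V = D')"

lemma unimod_equivI: "invertible U \<Longrightarrow> invertible V \<Longrightarrow> U ** D ** V = D' \<Longrightarrow> unimod_equiv D D'"
  unfolding unimod_equiv_def by blast

lemma invertible_mat_1: "invertible (mat 1 :: 'a::semiring_1^'n^'n)"
  unfolding invertible_def by (rule exI[of _ "mat 1"]) simp

lemma invertibleE:
  assumes "invertible U"
  obtains U' where "U ** U' = mat 1" "U' ** U = mat 1" "invertible U'"
  using assms unfolding invertible_def by blast

lemma unimod_equiv_refl: "unimod_equiv D D"
  by (rule unimod_equivI[OF invertible_mat_1 invertible_mat_1]) simp

lemma unimod_equiv_trans:
  assumes "unimod_equiv D D'" "unimod_equiv D' D''"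
  shows "unimod_equiv D D''"
proof -
  obtain U V where 1: "invertible U" "invertible V" "U ** D ** V = D'"
    using assms(1) unfolding unimod_equiv_def by blast
  obtain U' V' where 2: "invertible U'" "invertible V'" "U' ** D' ** V' = D''"
    using assms(2) unfolding unimod_equiv_def by blast
  have "(U' ** U) ** D ** (V ** V') = U' ** (U ** D ** V) ** V'" by (simp only: matrix_mul_assoc)
  then have "(U' ** U) ** D ** (V ** V') = D''" using 1 2 by simp
  then show ?thesis using 1 2 by (intro unimod_equivI[of "U' ** U" "V ** V'"] invertible_mult)
qed

lemma unimod_equiv_sym:
  assumes "unimod_equiv D D'"
  shows "unimod_equiv D' D"
proof -
  obtain U V where 1: "invertible U" "invertible V" "U ** D ** V = D'"
    using assms(1) unfolding unimod_equiv_def by blast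
  obtain U' where U': "U ** U' = mat 1" "U' ** U = mat 1" "invertible U'" using 1(1) by (rule invertibleE)
  obtain V' where V': "V ** V' = mat 1" "V' ** V = mat 1" "invertible V'" using 1(2) by (rule invertibleE)
  have "U' ** D' ** V' = (U' ** U) ** D ** (V ** V')" unfolding 1(3)[symmetric] by (simp only: matrix_mul_assoc)
  then have "U' ** D' ** V' = D" using U' V' by simp
  then show ?thesis by (rule unimod_equivI[OF U'(3) V'(3)])
qed

definition elementary :: "'n \<Rightarrow> 'n \<Rightarrow> 'a \<Rightarrow> ('a::comm_ring_1)^'n^'n" where
  "elementary p q f = (\<chi> i j. of_bool (i = j) + of_bool (i = p \<and> j = q) * f)"

lemma elementary_mult_left:
  "(elementary p q f ** D) $ l $ i = D $ l $ i + of_bool (l = p) * (f * D $ q $ i)"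
proof -
  have "elementary p q f $ l $ t * D $ t $ i =
      (if t = l then D $ l $ i else 0) + (if t = q then of_bool (l = p) * (f * D $ q $ i) else 0)" for t
    by (auto simp: elementary_def distrib_right mult.assoc)
  then show ?thesis by (simp add: matrix_matrix_mult_def sum.distrib)
qed

lemma elementary_mult_right:
  "(D ** elementary q p f) $ l $ i = D $ l $ i + of_bool (i = p) * (D $ l $ q * f)"
proof -
  have "D $ l $ t * elementary q p f $ t $ i =
      (if t = i then D $ l $ i else 0) + (if t = q then of_bool (i = p) * (D $ l $ q * f) else 0)" for t
    by (auto simp: elementary_def distrib_left)
  then show ?thesis by (simp add: matrix_matrix_mult_def sum.distrib)
qed

lemma invertible_elementary:
  fixes f :: "'a::comm_ring_1"
  assumes "p \<noteq> q"
  shows "invertible (elementary p q f)"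
proof -
  have "elementary p q f ** elementary p q (- f) = mat 1" for f :: 'a
    unfolding vec_eq_iff elementary_mult_left using assms by (auto simp: elementary_def mat_def)
  from this[of f] this[of "- f"] show ?thesis unfolding invertible_def by auto
qed

definition cmat :: "real^'m^'n \<Rightarrow> (real poly)^'m^'n" where
  "cmat C = (\<chi> i j. [:C $ i $ j:])"

lemma const_poly_sum: "[:\<Sum>t\<in>S. f t:] = (\<Sum>t\<in>S. [:f t:])"
proof (rule poly_eqI)
  fix n show "coeff [:\<Sum>t\<in>S. f t:] n = coeff (\<Sum>t\<in>S. [:f t:]) n"
    by (cases n) (simp_all add: coeff_sum)
qed

lemma cmat_mult: "cmat (A ** B) = cmat A ** cmat B"
  by (simp add: vec_eq_iff cmat_def matrix_matrix_mult_def const_poly_sum mult.commute)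

lemma cmat_mat_1: "cmat (mat 1) = mat 1"
  by (simp add: vec_eq_iff cmat_def mat_def one_pCons)

lemma invertible_cmat: "invertible C \<Longrightarrow> invertible (cmat C)"
  unfolding invertible_def by (metis cmat_mult cmat_mat_1)

lemma coeff_cmat_mult: "coeff ((cmat C ** D) $ l $ i) j = (\<Sum>t\<in>UNIV. C $ l $ t * coeff (D $ t $ i) j)"
  by (simp add: cmat_def matrix_matrix_mult_def coeff_sum)

lemma char_matrix_cmat: "char_matrix A = mat [:0, 1:] - cmat A"
  by (simp add: char_matrix_def cmat_def)

text \<open>Column-reduced with column degrees \<open>k\<close>, and normalised so that the matrix of the leading column
  coefficients is the identity.\<close>

definition col_monic :: "('n \<Rightarrow> nat) \<Rightarrow> (real poly)^'n^'n \<Rightarrow> bool" where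
  "col_monic k D \<longleftrightarrow> (\<forall>l i j. k i \<le> j \<longrightarrow> coeff (D $ l $ i) j = of_bool (l = i \<and> j = k i))"

text \<open>Left multiplication by the inverse of the leading coefficient matrix is unimodular,
  being constant, and raises no column degree.\<close>

lemma col_monic_normalize:
  assumes "\<And>l i j. k i < j \<Longrightarrow> coeff (D $ l $ i) j = 0"
    and "invertible (\<chi> l i. coeff (D $ l $ i) (k i))" (is "invertible ?L")
  obtains D' where "unimod_equiv D D'" "col_monic k D'"
proof -
  obtain B where B: "B ** ?L = mat 1" "invertible B" using assms(2) by (rule invertibleE) 
  have "coeff ((cmat B ** D) $ l $ i) j = of_bool (l = i \<and> j = k i)" if "k i \<le> j" for l i j
  proof (cases "j = k i")
    case True
    have "(B ** ?L) $ l $ i = of_bool (l = i)" using B by (simp add: mat_def)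
    then show ?thesis using True by (simp only: coeff_cmat_mult) (simp add: matrix_matrix_mult_def)
  next
    case False
    then show ?thesis using that assms(1) by (simp add: coeff_cmat_mult)
  qed
  then have "col_monic k (cmat B ** D)" unfolding col_monic_def by blast
  moreover have "unimod_equiv D (cmat B ** D)"
    by (rule unimod_equivI[of "cmat B" "mat 1"]) (simp_all add: B invertible_cmat invertible_mat_1)
  ultimately show ?thesis using that by blast
qed

text \<open>The row operation raises the degree of column \<open>q\<close>, the column operation then cancels the leading
  coefficient of column \<open>p\<close>; the new leading coefficient matrix is invertible because the new entry
  at \<open>(q, p)\<close> has leading coefficient \<open>c - (1 + c) = -1\<close>.\<close>

lemma col_monic_transfer:
  assumes D: "col_monic k D" and pq: "k q + 2 \<le> k p"
  obtains D' where "unimod_equiv D D'" "col_monic (k(p := k p - 1, q := k q + 1)) D'"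
proof -
  have ne: "p \<noteq> q" using pq by auto
  have cD: "coeff (D $ l $ i) j = of_bool (l = i \<and> j = k i)" if "k i \<le> j" for l i j
    using D that unfolding col_monic_def by blast
  define c where "c = coeff (D $ q $ p) (k p - 1)"
  \<comment> \<open>After the row operation the (p, p) entry has coefficient 1 + c at degree k p,
    and the (p, q) entry has leading coefficient 1 at degree k q + 1. Adding g times column q to
    column p cancels the former.\<close>
  define g where "g = - monom (1 + c) (k p - k q - 1)"
  define D2 where "D2 = elementary p q [:0, 1:] ** D ** elementary q p g"
  let ?k = "k(p := k p - 1, q := k q + 1)"
  have D2: "D2 $ l $ i = D $ l $ i + of_bool (l = p) * pCons 0 (D $ q $ i)
      + of_bool (i = p) * ((D $ l $ q + of_bool (l = p) * pCons 0 (D $ q $ q)) * g)" for l i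
    unfolding D2_def elementary_mult_right elementary_mult_left by simp
  have coeff_g: "coeff (r * g) j = - ((1 + c) * coeff r (j - (k p - k q - 1)))" if "j \<ge> k p - k q - 1" for r j
  proof -
    have "r * g = - (monom (1 + c) (k p - k q - 1) * r)" unfolding g_def by simp
    then show ?thesis using that by (simp add: coeff_monom_mult)
  qed
  have coeff_X: "coeff (pCons 0 r) j = coeff r (j - 1)" if "j \<ge> 1" for r :: "real poly" and j
    using that by (cases j) auto
  have other: "coeff (D2 $ l $ i) j = coeff (D $ l $ i) j + of_bool (l = p) * coeff (pCons 0 (D $ q $ i)) j"
    if "i \<noteq> p" for l i j
    using that unfolding D2 by simp
  have colp: "coeff (D2 $ l $ p) j = coeff (D $ l $ p) j + of_bool (l = p) * coeff (D $ q $ p) (j - 1)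
      - (1 + c) * (coeff (D $ l $ q) (j - (k p - k q - 1))
        + of_bool (l = p) * coeff (D $ q $ q) (j - (k p - k q - 1) - 1))" if "j \<ge> k p - 1" "l = p \<Longrightarrow> j \<ge> k p" for l j
  proof -
    define r where "r = D $ l $ q + of_bool (l = p) * pCons 0 (D $ q $ q)"
    have j: "j \<ge> k p - k q - 1" "l = p \<Longrightarrow> j \<ge> 1" "l = p \<Longrightarrow> j - (k p - k q - 1) \<ge> 1" using that pq by auto
    have "coeff (D2 $ l $ p) j = coeff (D $ l $ p) j + of_bool (l = p) * coeff (D $ q $ p) (j - 1) + coeff (r * g) j"
      using j(2) unfolding D2 r_def[symmetric] by (simp add: coeff_X)
    moreover have "coeff r (j - (k p - k q - 1)) = coeff (D $ l $ q) (j - (k p - k q - 1))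
        + of_bool (l = p) * coeff (D $ q $ q) (j - (k p - k q - 1) - 1)"
      using j(3) unfolding r_def by (cases "l = p") (simp_all add: coeff_X)
    ultimately show ?thesis using coeff_g[OF j(1), of r] by (simp only: diff_conv_add_uminus)
  qed
  have zero: "coeff (D2 $ l $ i) j = 0" if j: "?k i < j" for l i j
  proof (cases "i = p")
    case True
    have jk: "j \<ge> k p" using j True ne by auto
    have j1: "j - (k p - k q - 1) \<ge> k q + 1" using jk pq by auto
    have z: "coeff (D $ l $ q) (j - (k p - k q - 1)) = 0" using j1 by (subst cD) auto
    show ?thesis
    proof (cases "l = p")
      case lp: True
      show ?thesis
      proof (cases "j = k p")
        case True
        have "j - (k p - k q - 1) - 1 = k q" using True pq by auto
        then show ?thesis using colp[of j l] z jk lp True \<open>i = p\<close> cD[of p "k p" p] cD[of q "k q" q]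
          by (simp add: c_def)
      next
        case False
        then have "j - 1 \<ge> k p" "j - (k p - k q - 1) - 1 > k q" using jk pq by auto
        then show ?thesis using colp[of j l] z jk lp False \<open>i = p\<close> cD[of p j p] cD[of p "j - 1" q]
            cD[of q "j - (k p - k q - 1) - 1" q] ne by simp
      qed
    next
      case False
      then show ?thesis using colp[of j l] z jk True cD[of p j l] by simp
    qed
  next
    case False
    have "j \<ge> 1" "k i < j" using j False by (auto split: if_splits)
    moreover have "coeff (D $ q $ i) (j - 1) = 0"
      using j False by (subst cD) (auto split: if_splits)
    ultimately show ?thesis using False by (simp add: other coeff_X cD)
  qed
  \<comment> \<open>Row q of L is zero except for -1 in column p; the rows other than p and q agree
    with the identity off column p; row p has 1 in column q and unspecified entries elsewhere. A
    kernel vector therefore vanishes first at p, then at every index other than q, and finally at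
    q.\<close>
  define L where "L = (\<chi> l i. coeff (D2 $ l $ i) (?k i))"
  have Lq: "L $ q $ i = - of_bool (i = p)" for i
  proof -
    have "k p - Suc 0 - (k p - Suc (k q)) = k q" using pq by auto
    then have "L $ q $ p = - 1"
      using colp[of "k p - 1" q] cD[of q "k q" q] ne by (simp add: L_def c_def)
    moreover have "L $ q $ i = 0" if "i \<noteq> p"
      using that ne unfolding L_def by (auto simp: other cD)
    ultimately show ?thesis by auto
  qed
  have Ll: "L $ l $ i = of_bool (i = l)" if "l \<noteq> p" "l \<noteq> q" "i \<noteq> p" for l i
    using that unfolding L_def by (auto simp: other cD)
  have Lp: "L $ p $ q = 1"
    using ne cD[of q "k q" q] unfolding L_def by (simp add: other cD)
  have "x = 0" if "L *v x = 0" for x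
  proof -
    have row: "(\<Sum>i\<in>UNIV. L $ l $ i * x $ i) = 0" for l
      using that by (simp add: vec_eq_iff matrix_vector_mult_def)
    have xp: "x $ p = 0"
    proof -
      have "L $ q $ i * x $ i = (if i = p then - (x $ p) else 0)" for i by (simp add: Lq)
      then show ?thesis using row[of q] by simp
    qed
    have xl: "x $ l = 0" if "l \<noteq> q" for l
    proof (cases "l = p")
      case False
      have "L $ l $ i * x $ i = (if i = l then x $ l else 0)" for i
        using Ll[of l i] False that xp by (cases "i = p") auto
      then show ?thesis using row[of l] by simp
    qed (use xp in simp)
    have "L $ p $ i * x $ i = (if i = q then x $ q else 0)" for i
      using Lp xl by auto
    then have "x $ q = 0" using row[of p] by simp
    then show "x = 0" using xl by (metis vec_eq_iff zero_index)
  qed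
  then have "invertible L"
    using matrix_left_invertible_ker[of L] invertible_left_inverse[of L] by blast
  then obtain D' where D': "unimod_equiv D2 D'" "col_monic ?k D'"
    using col_monic_normalize[of ?k D2] zero unfolding L_def by blast
  have "unimod_equiv D D2"
    unfolding D2_def using ne by (intro unimod_equivI[OF _ _ refl] invertible_elementary) auto
  then show ?thesis using that unimod_equiv_trans D' by blast
qed

text \<open>The predicate given to \<open>transfer_reachable\<close> says that a degree sequence is
  attained by some equivalent matrix; \<open>col_monic_transfer\<close> supplies the unit
  moves.\<close>

lemma col_monic_majorized:
  fixes e :: "'n::finite \<Rightarrow> nat" and D :: "(real poly)^'n^'n"
  assumes e: "bij_betw e UNIV {1..n}"
    and "col_monic (\<lambda>i. d (e i)) D"
    and "\<And>i j. 1 \<le> i \<Longrightarrow> i \<le> j \<Longrightarrow> j \<le> n \<Longrightarrow> k j \<le> k i"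
    and "\<And>j. j \<le> n \<Longrightarrow> (\<Sum>i=1..j. k i) \<le> (\<Sum>i=1..j. d i)"
    and "(\<Sum>i=1..n. k i) = (\<Sum>i=1..n. d i)"
  obtains D' where "unimod_equiv D D'" "col_monic (\<lambda>i. k (e i)) D'"
proof -
  define P where "P x \<longleftrightarrow> (\<exists>D'. unimod_equiv D D' \<and> col_monic (\<lambda>i. x (e i)) D')" for x
  have step: "P (x(p := x p - 1, q := x q + 1))" if x: "P x" "p \<in> {1..n}" "q \<in> {1..n}" "x p \<ge> x q + 2" for x p q
  proof -
    obtain D' where D': "unimod_equiv D D'" "col_monic (\<lambda>i. x (e i)) D'" using x unfolding P_def by blast
    obtain p' q' where pq: "p = e p'" "q = e q'" using x(2,3) e unfolding bij_betw_def by blast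
    obtain D'' where D'': "unimod_equiv D' D''"
      "col_monic ((\<lambda>i. x (e i))(p' := x (e p') - 1, q' := x (e q') + 1)) D''"
      using col_monic_transfer[OF D'(2), of q' p'] x(4) pq by auto
    have "(\<lambda>i. x (e i))(p' := x (e p') - 1, q' := x (e q') + 1) = (\<lambda>i. (x(p := x p - 1, q := x q + 1)) (e i))"
      using e unfolding bij_betw_def pq by (auto simp: fun_eq_iff inj_eq)
    then show ?thesis unfolding P_def using D' D'' unimod_equiv_trans by metis
  qed
  have "P d" unfolding P_def using assms(2) unimod_equiv_refl by blast
  then obtain x where x: "P x" "\<And>i. i \<in> {1..n} \<Longrightarrow> x i = k i"
    using transfer_reachable[of P n k d] step assms(3-5) by blast
  moreover have "e i \<in> {1..n}" for i using e unfolding bij_betw_def by blast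
  ultimately have "(\<lambda>i. x (e i)) = (\<lambda>i. k (e i))" by blast
  with x(1) show ?thesis using that unfolding P_def by metis
qed

lemma col_monic_1_eq_char_matrix:
  assumes "col_monic (\<lambda>_. 1) D"
  shows "D = char_matrix (\<chi> l i. - coeff (D $ l $ i) 0)"
proof -
  have "D $ l $ i = char_matrix (\<chi> l i. - coeff (D $ l $ i) 0) $ l $ i" for l i
  proof (rule poly_eqI)
    fix j
    show "coeff (D $ l $ i) j = coeff (char_matrix (\<chi> l i. - coeff (D $ l $ i) 0) $ l $ i) j"
      using assms unfolding col_monic_def char_matrix_def
      by (cases j) (auto simp: mat_def coeff_pCons split: nat.splits)
  qed
  then show ?thesis unfolding vec_eq_iff by blast
qed

section \<open>The polynomial module of a matrix\<close>

definition cvec :: "real^'n \<Rightarrow> (real poly)^'n" where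
  "cvec c = (\<chi> i. [:c $ i:])"

lemma cvec_0: "cvec 0 = 0" and cvec_add: "cvec (a + b) = cvec a + cvec b"
  and cvec_scale: "cvec (r *\<^sub>R a) = [:r:] *s cvec a"
  by (simp_all add: cvec_def vec_eq_iff)

lemma mat_vector_mult: "mat c *v v = (c::'a::comm_semiring_1) *s v"
proof -
  have "mat c $ i $ j * v $ j = (if j = i then c * v $ i else 0)" for i j
    by (simp add: mat_def)
  then have "(mat c *v v) $ i = (\<Sum>j\<in>UNIV. if j = i then c * v $ i else 0)" for i
    unfolding matrix_vector_mult_def by simp
  then show ?thesis by (simp add: vec_eq_iff)
qed

lemma matrix_vector_smult: "A *v (c *s v) = (c::'a::comm_semiring_1) *s (A *v v)"
  by (simp add: vec_eq_iff matrix_vector_mult_def sum_distrib_left mult_ac)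

lemma cmat_cvec: "cmat A *v cvec c = cvec (A *v c)"
  by (simp add: vec_eq_iff cmat_def cvec_def matrix_vector_mult_def const_poly_sum mult.commute)

lemma char_matrix_mult_vec: "char_matrix A *v v = [:0, 1:] *s v - cmat A *v v"
  by (simp add: char_matrix_cmat matrix_vector_mult_diff_rdistrib mat_vector_mult)

section \<open>Division with remainder by sI - A\<close>

lemma coeff_bound: "\<exists>N. \<forall>i::'n::finite. \<forall>j\<ge>N. coeff (v i) j = 0"
proof -
  have "coeff (v i) j = 0" if "j \<ge> Suc (\<Sum>i\<in>UNIV. degree (v i))" for i j
  proof (rule coeff_eq_0)
    have "degree (v i) \<le> (\<Sum>i\<in>UNIV. degree (v i))" by (rule member_le_sum) auto
    then show "degree (v i) < j" using that by simp
  qed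
  then show ?thesis by blast
qed

lemma poly_vec_decomp:
  fixes v :: "(real poly)^'n"
  assumes "\<And>i j. Suc N \<le> j \<Longrightarrow> coeff (v $ i) j = 0"
  obtains c w where "v = cvec c + [:0, 1:] *s w" "\<And>i j. N \<le> j \<Longrightarrow> coeff (w $ i) j = 0"
proof -
  have "\<forall>i. \<exists>a p. v $ i = pCons a p" by (metis pCons_cases)
  then obtain a p where v: "\<And>i. v $ i = pCons (a i) (p i)" by metis
  have "v = cvec (\<chi> i. a i) + [:0, 1:] *s (\<chi> i. p i)"
    by (simp add: vec_eq_iff v cvec_def)
  moreover have "coeff ((\<chi> i. p i) $ i) j = 0" if "N \<le> j" for i j
    using assms[of "Suc j" i] that v by simp
  ultimately show ?thesis using that by blast
qed

text \<open>Horner's scheme: s c = (sI - A) c + A c trades a power of s for an application of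
  A.\<close>

lemma char_matrix_division_exists: "\<exists>w c. v = char_matrix A *v w + cvec c"
proof -
  obtain N where "\<And>i j. N \<le> j \<Longrightarrow> coeff (v $ i) j = 0" using coeff_bound[of "\<lambda>i. v $ i"] by blast
  then show ?thesis
  proof (induction N arbitrary: v)
    case 0
    then have "v = 0" by (simp add: vec_eq_iff poly_eq_iff)
    then have "v = char_matrix A *v 0 + cvec 0" by (simp add: cvec_0)
    then show ?case by blast
  next
    case (Suc N)
    obtain c w where v: "v = cvec c + [:0, 1:] *s w" and w: "\<And>i j. N \<le> j \<Longrightarrow> coeff (w $ i) j = 0"
      using poly_vec_decomp[OF Suc.prems] by metis
    obtain w1 c1 where w1: "w = char_matrix A *v w1 + cvec c1" using Suc.IH[OF w] by blast
    have "char_matrix A *v ([:0, 1:] *s w1 + cvec c1) =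
        [:0, 1:] *s (char_matrix A *v w1) + [:0, 1:] *s cvec c1 - cvec (A *v c1)"
      by (simp add: matrix_vector_right_distrib matrix_vector_smult char_matrix_mult_vec[of A "cvec c1"] cmat_cvec)
    then have "v = char_matrix A *v ([:0, 1:] *s w1 + cvec c1) + cvec (c + A *v c1)"
      unfolding v w1 by (simp add: vector_add_ldistrib cvec_add)
    then show ?case by blast
  qed
qed

lemma coeff_char_matrix_mult:
  "coeff ((char_matrix A *v w) $ i) (Suc j) = coeff (w $ i) j - (\<Sum>t\<in>UNIV. A $ i $ t * coeff (w $ t) (Suc j))"
  by (simp add: char_matrix_mult_vec) (simp add: matrix_vector_mult_def cmat_def coeff_sum)

text \<open>As s has the identity as its coefficient in sI - A, the top coefficient of a nonzero w
  would reappear one degree higher. This gives uniqueness of remainders.\<close>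

lemma char_matrix_mult_const:
  assumes "char_matrix A *v w = cvec c"
  shows "w = 0"
proof -
  obtain N where N: "\<And>i j. N \<le> j \<Longrightarrow> coeff (w $ i) j = 0" using coeff_bound[of "\<lambda>i. w $ i"] by blast
  have "coeff (w $ i) j = 0" for i j
  proof (rule inc_induct[of 0 N "\<lambda>n. \<forall>j\<ge>n. \<forall>i. coeff (w $ i) j = 0", THEN spec, THEN mp, THEN spec])
    fix n assume *: "\<forall>j\<ge>Suc n. \<forall>i. coeff (w $ i) j = 0"
    have "coeff (w $ i) n = 0" for i
      using coeff_char_matrix_mult[of A w i n] * assms by (simp add: cvec_def)
    then show "\<forall>j\<ge>n. \<forall>i. coeff (w $ i) j = 0" using * by (metis le_neq_implies_less Suc_leI)
  qed (use N in auto)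
  then show ?thesis by (simp add: vec_eq_iff poly_eq_iff)
qed

text \<open>The action of \<open>A\<close> makes \<open>real^'n\<close> a module over the polynomials; \<open>char_rem A\<close> is the module
  homomorphism from the free module that maps the unit vectors to the unit vectors. Its kernel is the
  range of \<open>char_matrix A\<close>.\<close>

definition char_rem :: "real^'n^'n \<Rightarrow> (real poly)^'n \<Rightarrow> real^'n" where
  "char_rem A v = (THE c. \<exists>w. v = char_matrix A *v w + cvec c)"

lemma char_rem_eqI:
  assumes "v = char_matrix A *v w + cvec c"
  shows "char_rem A v = c"
  unfolding char_rem_def
proof (rule the_equality)
  fix c' assume "\<exists>w. v = char_matrix A *v w + cvec c'"
  then obtain w' where "v = char_matrix A *v w' + cvec c'" by blast
  then have *: "char_matrix A *v (w - w') = cvec (c' - c)"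
  proof -
    have "X - Y = b - a" if "X + a = Y + b" for X Y a b :: "(real poly)^'n"
      using that by (simp add: algebra_simps)
    then have "char_matrix A *v w - char_matrix A *v w' = cvec c' - cvec c"
      using assms \<open>v = char_matrix A *v w' + cvec c'\<close> by metis
    moreover have "cvec c' - cvec c = cvec (c' - c)" by (simp add: cvec_def vec_eq_iff)
    ultimately show ?thesis by (simp add: matrix_vector_mult_diff_distrib)
  qed
  then have "w - w' = 0" by (rule char_matrix_mult_const)
  then have "cvec (c' - c) = 0" using * by simp
  then show "c' = c" by (simp add: cvec_def vec_eq_iff)
qed (use assms in blast)

lemma char_rem_ex: "\<exists>w. v = char_matrix A *v w + cvec (char_rem A v)"
  using char_matrix_division_exists char_rem_eqI by metis

lemma char_rem_cvec: "char_rem A (cvec c) = c"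
  by (rule char_rem_eqI[of _ _ 0]) simp

lemma char_rem_mult: "char_rem A (char_matrix A *v w) = 0"
  by (rule char_rem_eqI[of _ _ w]) (simp add: cvec_0)

lemma char_rem_0: "char_rem A 0 = 0"
  using char_rem_mult[of A 0] by simp

lemma char_rem_add: "char_rem A (v + v') = char_rem A v + char_rem A v'"
proof -
  obtain w w' where "v = char_matrix A *v w + cvec (char_rem A v)"
    "v' = char_matrix A *v w' + cvec (char_rem A v')" using char_rem_ex by metis
  then have "v + v' = char_matrix A *v (w + w') + cvec (char_rem A v + char_rem A v')"
    unfolding matrix_vector_right_distrib cvec_add by (metis add.assoc add.left_commute)
  then show ?thesis by (rule char_rem_eqI)
qed

lemma char_rem_scale: "char_rem A ([:r:] *s v) = r *\<^sub>R char_rem A v"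
proof -
  obtain w where "v = char_matrix A *v w + cvec (char_rem A v)" using char_rem_ex by metis
  then have "[:r:] *s v = [:r:] *s (char_matrix A *v w + cvec (char_rem A v))" by simp
  then have "[:r:] *s v = char_matrix A *v ([:r:] *s w) + cvec (r *\<^sub>R char_rem A v)"
    by (simp only: matrix_vector_smult cvec_scale vector_add_ldistrib)
  then show ?thesis by (rule char_rem_eqI)
qed

lemma char_rem_X: "char_rem A ([:0, 1:] *s v) = A *v char_rem A v"
proof -
  obtain w where "v = char_matrix A *v w + cvec (char_rem A v)" using char_rem_ex by metis
  then have "[:0, 1:] *s v = [:0, 1:] *s (char_matrix A *v w + cvec (char_rem A v))" by simp
  also have "\<dots> = char_matrix A *v ([:0, 1:] *s w + cvec (char_rem A v)) + cvec (A *v char_rem A v)"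
    by (simp only: matrix_vector_right_distrib matrix_vector_smult vector_add_ldistrib
        char_matrix_mult_vec[of A "cvec (char_rem A v)"] cmat_cvec) simp
  finally show ?thesis by (rule char_rem_eqI)
qed

lemma char_rem_sum: "char_rem A (\<Sum>t\<in>S. v t) = (\<Sum>t\<in>S. char_rem A (v t))"
  by (induction S rule: infinite_finite_induct) (simp_all add: char_rem_0 char_rem_add)

lemma char_rem_monom: "char_rem A (monom 1 j *s v) = (((*v) A) ^^ j) (char_rem A v)"
proof (induction j)
  case (Suc j)
  have "monom 1 (Suc j) *s v = [:0, 1:] *s (monom 1 j *s v)"
    by (simp add: monom_Suc vector_smult_assoc)
  then show ?case using Suc by (simp only: char_rem_X funpow.simps o_apply)
qed simp

text \<open>U D = (sI - A) V^-1, so D presents the same module as sI - A. \<open>h l\<close> is the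
  image of the l-th generator, and column l of D is a relation: s^(k l) times this generator equals
  a combination of lower degree. That puts A^(k l) \<open>h l\<close> into the reachable space of
  step k l, as \<open>dim_reach_chain\<close> demands.\<close>

lemma dim_reach_col_monic:
  fixes A :: "real^'n^'n"
  assumes "unimod_equiv D (char_matrix A)" "col_monic k D" "(\<Sum>l\<in>UNIV. k l) = CARD('n)"
  obtains E where "subspace E" "\<And>i. dim (reach ((*v) A) E i) = (\<Sum>j<i. card {l. k l > j})"
proof -
  obtain U V where UV: "invertible U" "invertible V" "U ** D ** V = char_matrix A"
    using assms(1) unfolding unimod_equiv_def by blast
  obtain V' where V': "V ** V' = mat 1" "V' ** V = mat 1" using UV(2) by (rule invertibleE) 
  obtain U' where U': "U ** U' = mat 1" using UV(1) by (rule invertibleE) 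
  define h where "h l = char_rem A (column l U)" for l
  define E where "E = span (range h)"
  have lin: "linear ((*v) A)" by simp
  have sE: "subspace E" unfolding E_def by simp
  have U_cvec: "char_rem A (U *v cvec c) \<in> E" for c
  proof -
    have "char_rem A (U *v cvec c) = (\<Sum>l\<in>UNIV. c $ l *\<^sub>R h l)"
      unfolding matrix_mult_sum char_rem_sum h_def by (simp add: cvec_def char_rem_scale)
    then show ?thesis unfolding E_def by (simp add: span_sum span_scale span_base)
  qed
  \<comment> \<open>Horner evaluation: a polynomial vector of degree below N uses at most N - 1
    applications of A to vectors of E.\<close>
  have in_reach: "char_rem A (U *v v) \<in> reach ((*v) A) E N" if "\<And>i j. N \<le> j \<Longrightarrow> coeff (v $ i) j = 0" for v N
    using that
  proof (induction N arbitrary: v)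
    case 0
    then have "v = 0" by (simp add: vec_eq_iff poly_eq_iff)
    then show ?case by (simp add: char_rem_0)
  next
    case (Suc N)
    obtain c w where v: "v = cvec c + [:0, 1:] *s w" and w: "\<And>i j. N \<le> j \<Longrightarrow> coeff (w $ i) j = 0"
      using poly_vec_decomp[OF Suc.prems] by metis
    have "char_rem A (U *v v) = char_rem A (U *v cvec c) + A *v char_rem A (U *v w)"
      unfolding v by (simp add: matrix_vector_right_distrib matrix_vector_smult char_rem_add char_rem_X)
    then show ?case using U_cvec Suc.IH[OF w] by (subst reach.simps) blast
  qed
  have chain: "(((*v) A) ^^ k l) (h l) \<in> reach ((*v) A) E (k l)" for l
  proof -
    define r where "r = column l D - monom 1 (k l) *s axis l 1"
    have "coeff (r $ i) j = 0" if "k l \<le> j" for i j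
      using that assms(2) unfolding r_def col_monic_def by (auto simp: column_def axis_def)
    then have r: "char_rem A (U *v r) \<in> reach ((*v) A) E (k l)" by (rule in_reach)
    have "U *v axis l 1 = column l U"
      by (simp add: vec_eq_iff column_def matrix_vector_mult_def axis_def if_distrib cong: if_cong)
    moreover have "U *v column l D = char_matrix A *v column l V'"
    proof -
      have "U *v column l D = column l (U ** D)"
        by (simp add: vec_eq_iff column_def matrix_vector_mult_def matrix_matrix_mult_def)
      also have "U ** D = U ** D ** (V ** V')" using V' by simp
      also have "\<dots> = char_matrix A ** V'" using UV(3) by (simp add: matrix_mul_assoc)
      also have "column l (char_matrix A ** V') = char_matrix A *v column l V'"
        by (simp add: vec_eq_iff column_def matrix_vector_mult_def matrix_matrix_mult_def)
      finally show ?thesis .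
    qed
    moreover have "column l D = monom 1 (k l) *s axis l 1 + r" by (simp add: r_def)
    ultimately have "char_rem A (monom 1 (k l) *s column l U + U *v r) = 0"
      using char_rem_mult by (metis matrix_vector_right_distrib matrix_vector_smult)
    then have "(((*v) A) ^^ k l) (h l) = - char_rem A (U *v r)"
      by (simp add: char_rem_add char_rem_monom h_def eq_neg_iff_add_eq_0)
    then show ?thesis using r subspace_neg[OF subspace_reach[OF lin sE]] by simp
  qed
  \<comment> \<open>Every x is the remainder of U (U^-1 x), so a degree bound for the inverse of U
    bounds the number of steps needed to reach the whole space.\<close>
  obtain N where N: "\<And>i j. N \<le> j \<Longrightarrow> coeff (U' $ fst i $ snd i) j = 0"
    using coeff_bound[of "\<lambda>i. U' $ fst i $ snd i"] by blast
  have "x \<in> reach ((*v) A) E N" for x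
  proof -
    have "coeff ((U' *v cvec x) $ i) j = 0" if "N \<le> j" for i j
      using N[OF that, of "(i, _)"] by (simp add: matrix_vector_mult_def cvec_def coeff_sum)
    then have "char_rem A (U *v (U' *v cvec x)) \<in> reach ((*v) A) E N" by (rule in_reach)
    then show ?thesis using U' by (simp add: matrix_vector_mul_assoc char_rem_cvec)
  qed
  then have full: "reach ((*v) A) E N = UNIV" by blast
  have "dim (reach ((*v) A) E i) = (\<Sum>j<i. card {l. k l > j})" for i
    by (rule dim_reach_chain[OF lin E_def chain full]) (use assms(3) in simp)
  then show ?thesis using that sE by blast
qed

section \<open>Existence of a feedback\<close>

lemma matrix_add_rdistrib: "(A + B) ** C = A ** C + B ** (C :: 'a::semiring_1^'k^'n)"
  by (simp add: vec_eq_iff matrix_matrix_mult_def distrib_right sum.distrib)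

lemma matrix_diff_ldistrib: "A ** (B - C) = A ** B - A ** (C :: 'a::ring_1^'k^'n)"
  by (simp add: vec_eq_iff matrix_matrix_mult_def right_diff_distrib sum_subtractf)

lemma matrix_diff_rdistrib: "(A - B) ** C = A ** C - B ** (C :: 'a::ring_1^'k^'n)"
  by (simp add: vec_eq_iff matrix_matrix_mult_def left_diff_distrib sum_subtractf)

lemma mat_mult_left: "mat c ** M = (\<chi> i j. c * M $ i $ j)" for c :: "'a::comm_semiring_1"
proof -
  have "mat c $ i $ t * M $ t $ j = (if t = i then c * M $ i $ j else 0)" for i j t
    by (simp add: mat_def)
  then show ?thesis by (simp add: vec_eq_iff matrix_matrix_mult_def)
qed

lemma mat_mult_right: "M ** mat c = (\<chi> i j. c * M $ i $ j)" for c :: "'a::comm_semiring_1"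
proof -
  have "M $ i $ t * mat c $ t $ j = (if t = j then c * M $ i $ j else 0)" for i j t
    by (simp add: mat_def mult.commute)
  then show ?thesis by (simp add: vec_eq_iff matrix_matrix_mult_def)
qed

lemma char_matrix_similar:
  assumes "Q ** P = mat 1"
  shows "char_matrix (Q ** A ** P) = cmat Q ** char_matrix A ** cmat P"
proof -
  have "cmat Q ** char_matrix A ** cmat P = mat [:0, 1:] ** (cmat Q ** cmat P) - cmat Q ** cmat A ** cmat P"
    unfolding char_matrix_cmat matrix_diff_ldistrib matrix_diff_rdistrib
    by (simp add: matrix_mul_assoc mat_mult_left mat_mult_right)
  also have "cmat Q ** cmat P = mat 1" using assms by (metis cmat_mult cmat_mat_1)
  finally show ?thesis by (simp add: char_matrix_cmat cmat_mult)
qed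

lemma unimod_equiv_similar:
  assumes "Q ** P = mat 1"
  shows "unimod_equiv (char_matrix A) (char_matrix (Q ** A ** P))"
proof (rule unimod_equivI)
  have "P ** Q = mat 1" using assms matrix_left_right_inverse by blast
  then show "invertible (cmat Q)" "invertible (cmat P)"
    using assms unfolding invertible_def by (metis cmat_mult cmat_mat_1)+
qed (simp add: char_matrix_similar[OF assms])

lemma has_invariant_polynomials_iff:
  fixes A :: "real^'n^'n"
  shows "has_invariant_polynomials A \<alpha> \<longleftrightarrow>
    (\<forall>i\<in>{1..CARD('n)}. lead_coeff (\<alpha> i) = 1) \<and> (\<forall>i\<in>{1..<CARD('n)}. \<alpha> i dvd \<alpha> (Suc i)) \<and>
    (\<exists>e. bij_betw e UNIV {1..CARD('n)} \<and> unimod_equiv (char_matrix A) (\<chi> i j. if i = j then \<alpha> (e i) else 0))"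
  unfolding has_invariant_polynomials_def unimod_equiv_def by blast

lemma has_invariant_polynomials_similar:
  fixes A P Q :: "real^'n^'n"
  assumes "has_invariant_polynomials A \<alpha>" "Q ** P = mat 1"
  shows "has_invariant_polynomials (Q ** A ** P) \<alpha>"
  using assms(1) unimod_equiv_trans[OF unimod_equiv_sym[OF unimod_equiv_similar[OF assms(2)]]]
  unfolding has_invariant_polynomials_iff by blast

section \<open>Controllability indices and Brunovsky indices as conjugate partitions\<close>

lemma columns_mult: "columns (A ** B) = (\<lambda>x. A *v x) ` columns (B :: real^'m^'n)"
proof -
  have "column i (A ** B) = A *v column i B" for i
    by (simp add: vec_eq_iff column_def matrix_vector_mult_def matrix_matrix_mult_def)
  then show ?thesis unfolding columns_def by auto
qed

lemma span_columns: "span (columns G) = range (\<lambda>y. G *v y)" for G :: "real^'m^'n"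
proof
  have "column i G = G *v axis i 1" for i by (simp add: matrix_vector_mult_basis)
  then have "columns G \<subseteq> range (\<lambda>y. G *v y)" unfolding columns_def by auto
  then show "span (columns G) \<subseteq> range (\<lambda>y. G *v y)"
    by (rule span_minimal) (simp add: linear_subspace_image)
  show "range (\<lambda>y. G *v y) \<subseteq> span (columns G)"
    using matrix_vector_mult_in_columnspace by blast
qed

lemma ctrb_rank_eq: "ctrb_rank F G i = dim (reach ((*v) F) (span (columns G)) i)"
proof -
  have "span (\<Union>j<i. columns ((((**) F) ^^ j) G)) = reach ((*v) F) (span (columns G)) i"
  proof (induction i)
    case (Suc i)
    have "(\<Union>j<Suc i. columns ((((**) F) ^^ j) G)) = columns G \<union> (\<Union>j<i. columns ((((**) F) ^^ Suc j) G))"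
      unfolding lessThan_Suc_eq_insert_0 by auto
    also have "(\<Union>j<i. columns ((((**) F) ^^ Suc j) G)) = (\<lambda>x. F *v x) ` (\<Union>j<i. columns ((((**) F) ^^ j) G))"
      by (simp add: columns_mult image_UN)
    also have "span (columns G \<union> \<dots>) = {x + y |x y. x \<in> span (columns G) \<and>
        y \<in> (\<lambda>x. F *v x) ` reach ((*v) F) (span (columns G)) i}"
      unfolding span_Un linear_span_image[OF matrix_vector_mul_linear] Suc ..
    also have "\<dots> = reach ((*v) F) (span (columns G)) (Suc i)" by auto
    finally show ?case .
  qed simp
  then show ?thesis unfolding ctrb_rank_def by (metis dim_span)
qed

lemma controllable_reach: 
  fixes F :: "real^'n^'n"
  shows "controllable F G \<longleftrightarrow> reach ((*v) F) (span (columns G)) CARD('n) = UNIV"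
proof -
  have "subspace (reach ((*v) F) (span (columns G)) CARD('n))" by (simp add: subspace_reach)
  then show ?thesis unfolding controllable_def ctrb_rank_eq
    by (metis DIM_cart DIM_real dim_eq_full mult.right_neutral span_eq_iff dim_UNIV)
qed

lemma sum_list_take_map_upt:
  "sum_list (take j (map f [1..<N + 1])) = (\<Sum>i=1..min j N. f i :: nat)"
proof -
  have "take j (map f [1..<N + 1]) = map f [1..<min j N + 1]"
  proof -
    have "take j [1..<N + 1] = [1..<min j N + 1]"
    proof (cases "j \<le> N")
      case True
      then show ?thesis using take_upt[of 1 j "N + 1"] by (simp del: upt_Suc)
    qed (simp add: min_def)
    then show ?thesis by (simp only: take_map)
  qed
  then show ?thesis
    by (simp only: interv_sum_list_conv_sum_set_nat) (rule sum.cong, auto)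
qed

lemma brunovsky_index_antimono:
  assumes "1 \<le> i" "i \<le> j"
  shows "brunovsky_index F G j \<le> brunovsky_index F G i"
proof -
  have "brunovsky_index F G (Suc (Suc t)) \<le> brunovsky_index F G (Suc t)" for t
    using reach_concave[of "(*v) F" "span (columns G)" t]
    unfolding brunovsky_index_def ctrb_rank_eq by (simp del: reach.simps)
  then have "brunovsky_index F G (Suc (j - 1)) \<le> brunovsky_index F G (Suc (i - 1))"
    using lift_Suc_antimono_le[of "\<lambda>t. brunovsky_index F G (Suc t)" "i - 1" "j - 1"] assms by simp
  then show ?thesis using assms by simp
qed

lemma ctrb_rank_Suc: "ctrb_rank F G (Suc i) = ctrb_rank F G i + brunovsky_index F G (Suc i)"
proof -
  have "ctrb_rank F G i \<le> ctrb_rank F G (Suc i)"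
    unfolding ctrb_rank_eq by (rule dim_subset[OF reach_mono_Suc]) simp_all
  then show ?thesis by (simp add: brunovsky_index_def)
qed

lemma brunovsky_index_le:
  fixes F :: "real^'n^'n" and G :: "real^'m^'n"
  assumes "1 \<le> j"
  shows "brunovsky_index F G j \<le> CARD('n)" "brunovsky_index F G j \<le> CARD('m)"
proof -
  have "brunovsky_index F G 1 = dim (columns G)"
    unfolding brunovsky_index_def ctrb_rank_eq by (simp add: reach_1 del: reach.simps(2))
  moreover have "dim (columns G) \<le> CARD('n)" using dim_subset_UNIV[of "columns G"] by simp
  moreover have "dim (columns G) \<le> CARD('m)"
  proof -
    have "columns G = (\<lambda>i. column i G) ` UNIV" unfolding columns_def by auto
    then have "finite (columns G)" "card (columns G) \<le> CARD('m)" using card_image_le[of UNIV "\<lambda>i. column i G"] by simp_all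
    then show ?thesis using dim_le_card'[of "columns G"] by linarith
  qed
  ultimately show "brunovsky_index F G j \<le> CARD('n)" "brunovsky_index F G j \<le> CARD('m)"
    using brunovsky_index_antimono[OF order_refl assms, of F G] by linarith+
qed

lemma ctrb_index_antimono: "i \<le> j \<Longrightarrow> ctrb_index F G j \<le> ctrb_index F G i"
  unfolding ctrb_index_def by (rule card_mono) auto

text \<open>These zeros reconcile the list of m indices with the n columns of the polynomial
  matrices, whichever of m and n is larger.\<close>

lemma ctrb_index_eq_0:
  fixes F :: "real^'n^'n" and G :: "real^'m^'n"
  assumes "CARD('n) < l \<or> CARD('m) < l"
  shows "ctrb_index F G l = 0"
  using assms brunovsky_index_le[of _ F G] unfolding ctrb_index_def by force

text \<open>Counting the cells of a Young diagram by rows or by columns gives the same total, and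
  the Brunovsky indices telescope to the full rank.\<close>

lemma sum_ctrb_index:
  fixes F :: "real^'n^'n" and G :: "real^'m^'n"
  assumes "controllable F G"
  shows "(\<Sum>l=1..CARD('n). ctrb_index F G l) = CARD('n)"
proof -
  let ?n = "CARD('n)" and ?r = "brunovsky_index F G"
  have "(\<Sum>l=1..?n. ctrb_index F G l) = (\<Sum>l=1..?n. \<Sum>j=1..?n. of_bool (?r j \<ge> l))"
    unfolding ctrb_index_def by (intro sum.cong refl card_filter_sum) simp
  also have "\<dots> = (\<Sum>j=1..?n. \<Sum>l=1..?n. of_bool (?r j \<ge> l))" by (rule sum.swap)
  also have "\<dots> = (\<Sum>j=1..?n. ?r j)"
  proof (rule sum.cong[OF refl])
    fix j assume "j \<in> {1..?n}"
    then have "{l \<in> {1..?n}. ?r j \<ge> l} = {1..?r j}" using brunovsky_index_le(1)[of j F G] by auto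
    then show "(\<Sum>l=1..?n. of_bool (?r j \<ge> l)) = ?r j"
      using card_filter_sum[of "{1..?n}" "\<lambda>l. ?r j \<ge> l"] by simp
  qed
  also have "\<dots> = ctrb_rank F G ?n"
  proof -
    have "ctrb_rank F G i = (\<Sum>j=1..i. ?r j)" for i
      by (induction i) (simp_all add: ctrb_rank_Suc, simp add: ctrb_rank_def)
    then show ?thesis by simp
  qed
  finally show ?thesis using assms unfolding controllable_def by simp
qed

text \<open>Conjugation of partitions is an involution. Monotonicity enters because the positions of
  the Brunovsky indices that are at least l must form an initial segment. For j \<ge> n both sides
  are 0.\<close>

lemma card_ctrb_index_greater:
  fixes F :: "real^'n^'n" and G :: "real^'m^'n"
  assumes "controllable F G"
  shows "card {l \<in> {1..CARD('n)}. ctrb_index F G l > j} = brunovsky_index F G (Suc j)"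
proof (cases "j < CARD('n)")
  case True
  let ?n = "CARD('n)" and ?r = "brunovsky_index F G"
  have iff: "ctrb_index F G l > j \<longleftrightarrow> l \<le> ?r (Suc j)" for l
  proof
    assume "l \<le> ?r (Suc j)"
    then have "{1..Suc j} \<subseteq> {i \<in> {1..?n}. ?r i \<ge> l}"
      using True brunovsky_index_antimono[of _ "Suc j" F G] by fastforce
    then have "card {1..Suc j} \<le> ctrb_index F G l" unfolding ctrb_index_def by (rule card_mono[rotated]) simp
    then show "ctrb_index F G l > j" by simp
  next
    assume *: "ctrb_index F G l > j"
    show "l \<le> ?r (Suc j)"
    proof (rule ccontr)
      assume "\<not> l \<le> ?r (Suc j)"
      then have "{i \<in> {1..?n}. ?r i \<ge> l} \<subseteq> {1..j}"
        using brunovsky_index_antimono[of "Suc j" _ F G] by (force simp: not_less_eq_eq)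
      then have "ctrb_index F G l \<le> card {1..j}" unfolding ctrb_index_def by (rule card_mono[rotated]) simp
      then show False using * by simp
    qed
  qed
  have "?r (Suc j) \<le> ?n" by (rule brunovsky_index_le) simp
  then have "{l \<in> {1..?n}. ctrb_index F G l > j} = {1..?r (Suc j)}"
    unfolding iff by auto
  then show ?thesis by simp
next
  case False
  have "ctrb_index F G l \<le> CARD('n)" for l
  proof -
    have "ctrb_index F G l \<le> card {1..CARD('n)}" unfolding ctrb_index_def by (rule card_mono) auto
    then show ?thesis by simp
  qed
  then have "ctrb_index F G l \<le> j" for l using False order_trans not_less by blast
  then have "{l \<in> {1..CARD('n)}. ctrb_index F G l > j} = {}" by (auto simp: not_less)
  moreover have "ctrb_rank F G (Suc j) = CARD('n)" "ctrb_rank F G j = CARD('n)"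
  proof -
    have "ctrb_rank F G t = CARD('n)" if "t \<ge> CARD('n)" for t
      using assms that reach_mono[of "(*v) F" "span (columns G)" "CARD('n)" t]
      unfolding controllable_reach ctrb_rank_eq by (simp add: top.extremum_unique)
    then show "ctrb_rank F G (Suc j) = CARD('n)" "ctrb_rank F G j = CARD('n)" using False by simp_all
  qed
  ultimately show ?thesis by (simp only: brunovsky_index_def) simp
qed

theorem feedback_set_nonempty:
  fixes F :: "real^'n^'n" and G :: "real^'m^'n" and \<alpha> :: "nat \<Rightarrow> real poly"
  assumes ctrb: "controllable F G"
    and monic: "\<And>i. i \<in> {1..CARD('n)} \<Longrightarrow> lead_coeff (\<alpha> i) = 1"
    and dvd: "\<And>i. i \<in> {1..<CARD('n)} \<Longrightarrow> \<alpha> i dvd \<alpha> (Suc i)"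
    and maj: "majorized (map (ctrb_index F G) [1..<CARD('m) + 1])
           (map (\<lambda>k. degree (\<alpha> (CARD('n) - k + 1))) [1..<CARD('n) + 1])"
  shows "feedback_set F G \<alpha> \<noteq> {}"
proof -
  define n where "n = CARD('n)"
  define d where "d l = degree (\<alpha> (n - l + 1))" for l
  define k where "k = ctrb_index F G"
  have sum_k: "(\<Sum>l=1..n. k l) = n" unfolding k_def n_def by (rule sum_ctrb_index[OF ctrb])
  have sum_min: "(\<Sum>l=1..min j CARD('m). k l) = (\<Sum>l=1..j. k l)" for j
    by (rule sum.mono_neutral_left) (auto simp: k_def intro!: ctrb_index_eq_0)
  have le: "(\<Sum>l=1..j. k l) \<le> (\<Sum>l=1..j. d l)" if "j \<le> n" for j
  proof -
    have "(\<Sum>l=1..min j CARD('m). k l) \<le> (\<Sum>l=1..min j n. d l)"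
      using maj unfolding majorized_def sum_list_take_map_upt k_def d_def n_def by blast
    then show ?thesis using sum_min[of j] that by (simp add: min_absorb1)
  qed
  have "(\<Sum>l=1..n. k l) = (\<Sum>l=1..CARD('m). k l)"
  proof (cases "n \<le> CARD('m)")
    case True
    then show ?thesis by (intro sum.mono_neutral_left) (auto simp: k_def n_def intro!: ctrb_index_eq_0)
  next
    case False
    then show ?thesis using sum_min[of n] by simp
  qed
  also have "\<dots> = (\<Sum>l=1..n. d l)"
    using maj sum_list_take_map_upt[of "CARD('m)" "ctrb_index F G" "CARD('m)"]
      sum_list_take_map_upt[of n "\<lambda>l. degree (\<alpha> (CARD('n) - l + 1))" n]
    unfolding majorized_def by (simp add: k_def d_def[abs_def] n_def del: upt_Suc)
  finally have eq: "(\<Sum>l=1..n. k l) = (\<Sum>l=1..n. d l)" .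
  obtain e :: "'n \<Rightarrow> nat" where e: "bij_betw e UNIV {1..n}"
    using finite_same_card_bij[of "UNIV :: 'n set" "{1..n}"] unfolding n_def by auto
  have e_in: "e i \<in> {1..n}" for i using e unfolding bij_betw_def by blast
  \<comment> \<open>The numbering is reversed: majorization lists the degrees from
    \<open>\<alpha> n\<close> downwards, while the invariant polynomials increase under
    divisibility.\<close>
  define D0 :: "(real poly)^'n^'n" where "D0 = (\<chi> i j. if i = j then \<alpha> (n - e i + 1) else 0)"
  have rev: "bij_betw (\<lambda>l. n - l + 1) {1..n} {1..n}"
    by (rule bij_betw_byWitness[of _ "\<lambda>l. n - l + 1"]) auto
  have e': "bij_betw (\<lambda>i. n - e i + 1) UNIV {1..n}"
    using bij_betw_trans[OF e rev] by (simp add: o_def)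
  have "col_monic (\<lambda>i. d (e i)) D0"
    unfolding col_monic_def
  proof (intro allI impI)
    fix l i :: 'n and j assume j: "d (e i) \<le> j"
    have "n - e i + 1 \<in> {1..CARD('n)}" using e_in[of i] by (auto simp: n_def)
    from monic[OF this] show "coeff (D0 $ l $ i) j = of_bool (l = i \<and> j = d (e i))"
      using j by (auto simp: D0_def d_def intro!: coeff_eq_0)
  qed
  then obtain D1 where D1: "unimod_equiv D0 D1" "col_monic (\<lambda>i. k (e i)) D1"
    using col_monic_majorized[OF e, of d D0 k] le eq ctrb_index_antimono unfolding k_def by metis
  \<comment> \<open>The constant sequence 1 is majorized by k: either k j = 0 and the first j
    entries already sum to n, or all of them are at least 1.\<close>
  have "(\<Sum>i=1..j. (1::nat)) \<le> (\<Sum>i=1..j. k i)" if "j \<le> n" for j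
  proof (cases "k j = 0")
    case True
    have "k i = 0" if "j \<le> i" for i
      using ctrb_index_antimono[OF that, of F G] True unfolding k_def by simp
    then have "(\<Sum>i=1..n. k i) = (\<Sum>i=1..j. k i)"
      using \<open>j \<le> n\<close> by (intro sum.mono_neutral_right) auto
    then show ?thesis using sum_k that by simp
  next
    case False
    have "1 \<le> k i" if "i \<le> j" for i
      using ctrb_index_antimono[OF that, of F G] False unfolding k_def by simp
    then show ?thesis by (intro sum_mono) simp
  qed
  then obtain D2 where D2: "unimod_equiv D1 D2" "col_monic (\<lambda>i. 1) D2"
    using col_monic_majorized[OF e D1(2), of "\<lambda>_. 1"] sum_k by auto
  obtain A where A: "D2 = char_matrix A" using col_monic_1_eq_char_matrix[OF D2(2)] by blast
  have "has_invariant_polynomials A \<alpha>"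
    unfolding has_invariant_polynomials_iff
  proof (intro conjI ballI exI[of _ "\<lambda>i. n - e i + 1"])
    show "unimod_equiv (char_matrix A) (\<chi> i j. if i = j then \<alpha> (n - e i + 1) else 0)"
      using unimod_equiv_sym[OF unimod_equiv_trans[OF D1(1) D2(1)]] unfolding A D0_def .
  qed (use monic dvd e' in \<open>simp_all add: n_def\<close>)
  moreover
  have "(\<Sum>l\<in>UNIV. k (e l)) = CARD('n)"
    using sum.reindex_bij_betw[OF e, of k] sum_k by (simp add: n_def)
  \<comment> \<open>\<open>D1\<close> is equivalent to \<open>D2\<close>, hence presents the module
    of A too, but with the column degrees k.\<close>
  then obtain E where E: "subspace E" "\<And>i. dim (reach ((*v) A) E i) = (\<Sum>j<i. card {l. k (e l) > j})"
    using dim_reach_col_monic[of D1 A "\<lambda>l. k (e l)"] D1(2) D2(1) A by blast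
  have "card {l. k (e l) > j} = brunovsky_index F G (Suc j)" for j
  proof -
    have "e ` {l. k (e l) > j} = {l \<in> {1..n}. k l > j}" using e unfolding bij_betw_def by auto
    moreover have "inj_on e {l. k (e l) > j}" using e unfolding bij_betw_def by (auto intro: inj_on_subset)
    ultimately have "card {l. k (e l) > j} = card {l \<in> {1..n}. k l > j}" using card_image by metis
    then show ?thesis using card_ctrb_index_greater[OF ctrb, of j] by (simp add: n_def k_def)
  qed
  then have "dim (reach ((*v) A) E i) = ctrb_rank F G i" for i
    unfolding E(2) by (induction i) (simp_all add: ctrb_rank_Suc, simp add: ctrb_rank_def)
  then obtain T T' where T: "linear T" "linear T'" "\<And>x. T' (T x) = x" "\<And>x. T (T' x) = x"
    "\<And>x. T' (A *v T x) - F *v x \<in> span (columns G)"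
    using feedback_equivalence[of "(*v) F" "(*v) A" "span (columns G)" E "CARD('n)"] E(1) ctrb
    unfolding controllable_reach ctrb_rank_eq by (metis matrix_vector_mul_linear subspace_span)
  define P where "P = matrix T"
  define Q where "Q = matrix T'"
  have PQ: "P *v x = T x" "Q *v x = T' x" for x
    unfolding P_def Q_def using T matrix_works by auto
  have "(Q ** P) *v x = mat 1 *v x" for x
    unfolding matrix_vector_mul_assoc[symmetric] PQ using T by simp
  then have QP: "Q ** P = mat 1" by (simp add: matrix_eq)
  define B where "B = Q ** A ** P"
  have "(B - F) *v x \<in> range (\<lambda>y. G *v y)" for x
    using T(5)[of x] unfolding span_columns[symmetric] B_def
    by (simp add: matrix_vector_mult_diff_rdistrib matrix_vector_mul_assoc[symmetric] PQ)
  \<comment> \<open>B - F takes its values in the range of G, so it factors as G K, one column at a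
    time.\<close>
  then have "\<forall>j. \<exists>y. column j (B - F) = G *v y" by (metis matrix_vector_mult_basis rangeE)
  then obtain y where y: "\<And>j. column j (B - F) = G *v y j" by metis
  define K where "K = (\<chi> i j. y j $ i)"
  have "(G ** K) $ i $ j = (B - F) $ i $ j" for i j
  proof -
    have "(B - F) $ i $ j = column j (B - F) $ i" by (simp add: column_def)
    then show ?thesis unfolding y by (simp add: K_def matrix_matrix_mult_def matrix_vector_mult_def)
  qed
  then have "F + G ** K = B" by (simp add: vec_eq_iff)
  ultimately have "K \<in> feedback_set F G \<alpha>"
    using has_invariant_polynomials_similar[OF _ QP, of A \<alpha>]
    by (simp add: feedback_set_def similarity_class_def B_def)
  then show ?thesis by blast
qed

section \<open>Spaces of intertwiners\<close>

text \<open>The parameters are arbitrary functions, which do not form a Euclidean space. By the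
  condition on zeros, values outside I are ignored and values on I are determined, so the images of
  the indicators of the points of I form a basis of the range.\<close>

lemma dim_range_linear_param:
  fixes \<Phi> :: "('i \<Rightarrow> real) \<Rightarrow> 'a::euclidean_space"
  assumes fin: "finite I"
    and add: "\<And>c c'. \<Phi> (\<lambda>t. c t + c' t) = \<Phi> c + \<Phi> c'"
    and scale: "\<And>r c. \<Phi> (\<lambda>t. r * c t) = r *\<^sub>R \<Phi> c"
    and zero: "\<And>c. \<Phi> c = 0 \<longleftrightarrow> (\<forall>t\<in>I. c t = 0)"
  shows "dim (range \<Phi>) = card I"
proof -
  define b where "b t = \<Phi> (\<lambda>s. of_bool (s = t))" for t
  have \<Phi>_eq: "\<Phi> c = (\<Sum>t\<in>I. c t *\<^sub>R b t)" for c
  proof -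
    have "\<Phi> (\<lambda>t. if t \<in> S then c t else 0) = (\<Sum>t\<in>S. c t *\<^sub>R b t)" if "finite S" for S
      using that
    proof (induction S)
      case empty
      show ?case using zero[of "\<lambda>_. 0"] by simp
    next
      case (insert x S)
      have "(\<lambda>t. if t \<in> insert x S then c t else 0) =
          (\<lambda>t. c x * of_bool (t = x) + (if t \<in> S then c t else 0))"
        using insert(2) by (auto simp: fun_eq_iff)
      then show ?case using insert by (simp only: add scale) (simp add: b_def)
    qed
    moreover have "\<Phi> c = \<Phi> (\<lambda>t. if t \<in> I then c t else 0)"
    proof -
      have "\<Phi> c = \<Phi> (\<lambda>t. (if t \<in> I then c t else 0) + (if t \<in> I then 0 else c t))"
        by (rule arg_cong[where f = \<Phi>]) auto
      moreover have "\<Phi> (\<lambda>t. if t \<in> I then 0 else c t) = 0" using zero by simp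
      ultimately show ?thesis
        using add[of "\<lambda>t. if t \<in> I then c t else 0" "\<lambda>t. if t \<in> I then 0 else c t"] by simp
    qed
    ultimately show ?thesis using fin by simp
  qed
  have indep: "c t = 0" if "(\<Sum>t\<in>I. c t *\<^sub>R b t) = 0" "t \<in> I" for c t
    using zero[of c] that unfolding \<Phi>_eq by blast
  have inj: "inj_on b I"
  proof (rule inj_onI, rule ccontr)
    fix s t assume st: "s \<in> I" "t \<in> I" "b s = b t" "s \<noteq> t"
    have "(\<Sum>u\<in>I. (of_bool (u = s) - of_bool (u = t)) *\<^sub>R b u) =
        (\<Sum>u\<in>I. if u = s then b u else 0) - (\<Sum>u\<in>I. if u = t then b u else 0)"
      by (simp only: sum_subtractf[symmetric]) (rule sum.cong, auto)
    also have "\<dots> = 0" using st fin by simp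
    finally show False using indep[of "\<lambda>u. of_bool (u = s) - of_bool (u = t)" s] st by simp
  qed
  have "independent (b ` I)"
    unfolding dependent_finite[OF finite_imageI[OF fin]]
  proof clarify
    fix u t assume "(\<Sum>x\<in>b ` I. u x *\<^sub>R x) = 0" "u (b t) \<noteq> 0" "t \<in> I"
    then show False using indep[of "\<lambda>t. u (b t)" t] inj by (simp add: sum.reindex)
  qed
  moreover have "range \<Phi> = span (b ` I)"
  proof -
    have "\<Phi> c = (\<Sum>x\<in>b ` I. c (the_inv_into I b x) *\<^sub>R x)" for c
      using inj unfolding \<Phi>_eq by (simp add: sum.reindex the_inv_into_f_f)
    moreover have "(\<Sum>x\<in>b ` I. u x *\<^sub>R x) = \<Phi> (\<lambda>t. u (b t))" for u
      using inj unfolding \<Phi>_eq by (simp add: sum.reindex)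
    ultimately show ?thesis unfolding span_finite[OF finite_imageI[OF fin]]
      by (intro equalityI image_subsetI) (rule range_eqI, assumption)+
  qed
  ultimately show ?thesis using inj by (simp add: dim_eq_card_independent card_image)
qed

section \<open>Constant remainders of polynomial matrices and intertwiners\<close>

definition mat_rem :: "real^'n^'n \<Rightarrow> (real poly)^'k^'n \<Rightarrow> real^'k^'n" where
  "mat_rem A Q = (\<chi> i j. char_rem A (column j Q) $ i)"

lemma mat_rem_eqI:
  assumes "Q = char_matrix A ** R + cmat C"
  shows "mat_rem A Q = C"
proof -
  have "char_rem A (column j Q) = column j C" for j
  proof (rule char_rem_eqI)
    show "column j Q = char_matrix A *v column j R + cvec (column j C)"
      unfolding assms by (simp add: vec_eq_iff column_def cvec_def cmat_def matrix_matrix_mult_def matrix_vector_mult_def)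
  qed
  then show ?thesis by (simp add: mat_rem_def vec_eq_iff column_def)
qed

lemma mat_rem_ex: "\<exists>R. Q = char_matrix A ** R + cmat (mat_rem A Q)"
proof -
  have "\<forall>j. \<exists>w. column j Q = char_matrix A *v w + cvec (char_rem A (column j Q))"
    using char_rem_ex by blast
  then obtain w where w: "\<And>j. column j Q = char_matrix A *v w j + cvec (char_rem A (column j Q))"
    by metis
  have "Q $ i $ j = (char_matrix A ** (\<chi> i j. w j $ i) + cmat (mat_rem A Q)) $ i $ j" for i j
  proof -
    have "Q $ i $ j = column j Q $ i" by (simp add: column_def)
    also have "\<dots> = (char_matrix A *v w j) $ i + cvec (char_rem A (column j Q)) $ i" by (metis w vector_add_component)
    finally show ?thesis
      by (simp add: cvec_def cmat_def mat_rem_def matrix_matrix_mult_def matrix_vector_mult_def)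
  qed
  then show ?thesis unfolding vec_eq_iff by blast
qed

lemma mat_rem_cmat: "mat_rem A (cmat C) = C"
  by (rule mat_rem_eqI[of _ _ 0]) simp

lemma mat_rem_mult: "mat_rem A (char_matrix A ** R) = 0"
  by (rule mat_rem_eqI[of _ _ R]) (simp add: cmat_def vec_eq_iff)

lemma mat_rem_add: "mat_rem A (Q + Q') = mat_rem A Q + mat_rem A Q'"
proof -
  have "column j (Q + Q') = column j Q + column j Q'" for j by (simp add: column_def vec_eq_iff)
  then have "char_rem A (column j (Q + Q')) $ i = char_rem A (column j Q) $ i + char_rem A (column j Q') $ i" for i j
    by (simp only: char_rem_add vector_add_component)
  then show ?thesis by (simp add: mat_rem_def vec_eq_iff)
qed

lemma mat_rem_scale: "mat_rem A (mat [:r:] ** Q) = r *\<^sub>R mat_rem A Q"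
proof -
  have "column j (mat [:r:] ** Q) = [:r:] *s column j Q" for j
    by (simp add: column_def vec_eq_iff mat_mult_left)
  then have "char_rem A (column j (mat [:r:] ** Q)) $ i = r * char_rem A (column j Q) $ i" for i j
    by (simp only: char_rem_scale vector_scaleR_component real_scaleR_def)
  then show ?thesis by (simp add: mat_rem_def vec_eq_iff)
qed

text \<open>The terms in s cancel. The defect of intertwining is thus a constant matrix, which
  taking remainders modulo sI - B leaves unchanged.\<close>

lemma char_matrix_cmat_commute:
  "cmat M ** char_matrix A - char_matrix B ** cmat M = cmat (B ** M - M ** A)"
  unfolding char_matrix_cmat matrix_diff_ldistrib matrix_diff_rdistrib
  by (simp add: mat_mult_left mat_mult_right cmat_mult[symmetric]) (simp add: cmat_def vec_eq_iff)

lemma coeff_sum_monom: "coeff (\<Sum>k<N. monom (c k) k) j = (if j < N then c j else 0)"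
  by (simp add: coeff_sum)

lemma diag_mult_left: "((\<chi> i j. if i = j then d i else 0) ** X) $ i $ j = d i * (X $ i $ j :: 'a::comm_semiring_1)"
proof -
  have "(if i = t then d i else 0) * X $ t $ j = (if t = i then d i * X $ i $ j else 0)" for t
    by simp
  then show ?thesis by (simp add: matrix_matrix_mult_def)
qed

lemma diag_mult_right: "(X ** (\<chi> i j. if i = j then d i else 0)) $ i $ j = X $ i $ j * (d j :: 'a::comm_semiring_1)"
proof -
  have "X $ i $ t * (if t = j then d t else 0) = (if t = j then X $ i $ j * d j else 0)" for t
    by simp
  then show ?thesis by (simp add: matrix_matrix_mult_def)
qed

text \<open>A matrix \<open>M\<close> intertwines \<open>A\<close> and \<open>B\<close> iff it induces a homomorphism between the polynomial modules
  presented by the diagonal matrices. Such a homomorphism is a matrix \<open>Q\<close> whose \<open>(i, j)\<close> entry is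
  divisible by \<open>d' i / gcd (d' i) (d j)\<close>, taken modulo \<open>d' i\<close>.\<close>

lemma dim_intertwiners:
  fixes A B :: "real^'n^'n"
  assumes A: "unimod_equiv (char_matrix A) (\<chi> i j. if i = j then d i else 0)"
    and B: "unimod_equiv (char_matrix B) (\<chi> i j. if i = j then d' i else 0)"
    and d': "\<And>i j. d' i = f i j * g i j" "\<And>i. d' i \<noteq> 0"
    and f: "\<And>i j q. d' i dvd q * d j \<longleftrightarrow> f i j dvd q"
  shows "dim {M. B ** M = M ** A} = (\<Sum>i\<in>UNIV. \<Sum>j\<in>UNIV. degree (g i j))"
proof -
  let ?D = "\<chi> i j. if i = j then d i else 0" and ?D' = "\<chi> i j. if i = j then d' i else 0"
  obtain U V where UV: "invertible U" "invertible V" "U ** char_matrix A ** V = ?D"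
    using A unfolding unimod_equiv_def by blast
  obtain U' V' where UV': "invertible U'" "invertible V'" "U' ** char_matrix B ** V' = ?D'"
    using B unfolding unimod_equiv_def by blast
  obtain Ui where Ui: "U ** Ui = mat 1" "Ui ** U = mat 1" using UV(1) by (rule invertibleE)
  obtain Vi where Vi: "V ** Vi = mat 1" "Vi ** V = mat 1" using UV(2) by (rule invertibleE)
  obtain U'i where U'i: "U' ** U'i = mat 1" "U'i ** U' = mat 1" using UV'(1) by (rule invertibleE)
  obtain V'i where V'i: "V' ** V'i = mat 1" "V'i ** V' = mat 1" using UV'(2) by (rule invertibleE)
  have U'D': "U'i ** ?D' = char_matrix B ** V'"
  proof -
    have "U'i ** (U' ** char_matrix B ** V') = (U'i ** U') ** char_matrix B ** V'" by (simp only: matrix_mul_assoc)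
    then show ?thesis using UV'(3) U'i by simp
  qed
  have U'B: "U' ** char_matrix B = ?D' ** V'i"
  proof -
    have "U' ** char_matrix B ** V' ** V'i = U' ** char_matrix B ** (V' ** V'i)" by (simp only: matrix_mul_assoc)
    then show ?thesis using UV'(3) V'i by simp
  qed
  have UiD: "Ui ** ?D = char_matrix A ** V"
  proof -
    have "Ui ** (U ** char_matrix A ** V) = (Ui ** U) ** char_matrix A ** V" by (simp only: matrix_mul_assoc)
    then show ?thesis using UV(3) Ui by simp
  qed
  have UA: "U ** char_matrix A = ?D ** Vi"
  proof -
    have "U ** char_matrix A ** V ** Vi = U ** char_matrix A ** (V ** Vi)" by (simp only: matrix_mul_assoc)
    then show ?thesis using UV(3) Vi by simp
  qed
  \<comment> \<open>For a Q that respects the relations, \<open>\<rho> Q\<close> is the matrix of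
    the induced module map, carried back from the diagonal presentations to A and B.\<close>
  define \<rho> where "\<rho> Q = mat_rem B (U'i ** Q ** U)" for Q
  have \<rho>_add: "\<rho> (Q + Q') = \<rho> Q + \<rho> Q'" for Q Q'
    unfolding \<rho>_def by (simp add: matrix_add_ldistrib matrix_add_rdistrib mat_rem_add)
  have \<rho>_diff: "\<rho> (Q - Q') = \<rho> Q - \<rho> Q'" for Q Q'
    using \<rho>_add[of "Q - Q'" Q'] by simp
  have \<rho>_scale: "\<rho> (mat [:r:] ** Q) = r *\<^sub>R \<rho> Q" for r Q
  proof -
    have "U'i ** (mat [:r:] ** Q) ** U = mat [:r:] ** (U'i ** Q ** U)"
    proof -
      have "U'i ** (mat [:r:] ** Q) ** U = (U'i ** mat [:r:]) ** Q ** U" by (simp only: matrix_mul_assoc)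
      also have "U'i ** mat [:r:] = mat [:r:] ** U'i" by (simp only: mat_mult_left mat_mult_right)
      finally show ?thesis by (simp only: matrix_mul_assoc)
    qed
    then show ?thesis unfolding \<rho>_def by (simp only: mat_rem_scale)
  qed
  have \<rho>_0: "\<rho> Q = 0 \<longleftrightarrow> (\<forall>i j. d' i dvd Q $ i $ j)" for Q
  proof
    assume "\<rho> Q = 0"
    moreover obtain R where "U'i ** Q ** U = char_matrix B ** R + cmat (mat_rem B (U'i ** Q ** U))"
      using mat_rem_ex by blast
    ultimately have R: "U'i ** Q ** U = char_matrix B ** R"
      unfolding \<rho>_def by (simp add: cmat_def vec_eq_iff)
    have "Q = (U' ** U'i) ** Q ** (U ** Ui)" using U'i Ui by simp
    also have "\<dots> = U' ** (U'i ** Q ** U) ** Ui" by (simp only: matrix_mul_assoc)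
    also have "\<dots> = (U' ** char_matrix B) ** (R ** Ui)" unfolding R by (simp only: matrix_mul_assoc)
    also have "\<dots> = ?D' ** (V'i ** R ** Ui)" unfolding U'B by (simp only: matrix_mul_assoc)
    finally have Q: "Q = ?D' ** (V'i ** R ** Ui)" .
    have "Q $ i $ j = d' i * (V'i ** R ** Ui) $ i $ j" for i j by (subst Q) (rule diag_mult_left)
    then show "\<forall>i j. d' i dvd Q $ i $ j" by simp
  next
    assume dv: "\<forall>i j. d' i dvd Q $ i $ j"
    define X where "X = (\<chi> i j. Q $ i $ j div d' i)"
    have "Q $ i $ j = (?D' ** X) $ i $ j" for i j
      unfolding diag_mult_left using dv by (simp add: X_def)
    then have "Q = ?D' ** X" unfolding vec_eq_iff by blast
    then have "U'i ** Q ** U = (U'i ** ?D') ** (X ** U)" by (simp only: matrix_mul_assoc)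
    also have "\<dots> = char_matrix B ** (V' ** X ** U)" unfolding U'D' by (simp only: matrix_mul_assoc)
    finally show "\<rho> Q = 0" unfolding \<rho>_def by (simp only: mat_rem_mult)
  qed
  \<comment> \<open>Divisibility yields Q D = D' P with P polynomial, so relations go to relations.
    Transported back, everything is a multiple of sI - B except the constant defect of intertwining,
    which uniqueness of remainders forces to be 0.\<close>
  have \<rho>_intertwines: "B ** \<rho> Q = \<rho> Q ** A" if "\<And>i j. f i j dvd Q $ i $ j" for Q
  proof -
    define P where "P = (\<chi> i j. (Q $ i $ j * d j) div d' i)"
    have "(Q ** ?D) $ i $ j = (?D' ** P) $ i $ j" for i j
      unfolding diag_mult_left diag_mult_right using f that by (simp add: P_def)
    then have QD: "Q ** ?D = ?D' ** P" unfolding vec_eq_iff by blast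
    obtain R where R: "U'i ** Q ** U = char_matrix B ** R + cmat (\<rho> Q)"
      unfolding \<rho>_def using mat_rem_ex by blast
    have "(U'i ** Q ** U) ** char_matrix A = U'i ** Q ** (U ** char_matrix A)" by (simp only: matrix_mul_assoc)
    also have "\<dots> = U'i ** (Q ** ?D) ** Vi" unfolding UA by (simp only: matrix_mul_assoc)
    also have "\<dots> = (U'i ** ?D') ** P ** Vi" unfolding QD by (simp only: matrix_mul_assoc)
    also have "\<dots> = char_matrix B ** (V' ** P ** Vi)" unfolding U'D' by (simp only: matrix_mul_assoc)
    finally have "char_matrix B ** (V' ** P ** Vi) = char_matrix B ** (R ** char_matrix A) + cmat (\<rho> Q) ** char_matrix A"
      unfolding R by (simp only: matrix_add_rdistrib matrix_mul_assoc)
    moreover have "cmat (\<rho> Q) ** char_matrix A = char_matrix B ** cmat (\<rho> Q) + cmat (B ** \<rho> Q - \<rho> Q ** A)"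
      using char_matrix_cmat_commute[of "\<rho> Q" A B] by (simp add: algebra_simps)
    ultimately have "mat_rem B (char_matrix B ** (V' ** P ** Vi)) =
        mat_rem B (char_matrix B ** (R ** char_matrix A) + (char_matrix B ** cmat (\<rho> Q) + cmat (B ** \<rho> Q - \<rho> Q ** A)))"
      by simp
    then have "B ** \<rho> Q - \<rho> Q ** A = 0" unfolding mat_rem_add mat_rem_mult mat_rem_cmat by simp
    then show ?thesis by simp
  qed
  have \<rho>_onto: "\<exists>Q. \<rho> Q = M \<and> (\<forall>i j. f i j dvd Q $ i $ j)" if "B ** M = M ** A" for M
  proof (intro exI conjI allI)
    let ?Q = "U' ** cmat M ** Ui"
    have "U'i ** ?Q ** U = (U'i ** U') ** cmat M ** (Ui ** U)" by (simp only: matrix_mul_assoc)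
    then show "\<rho> ?Q = M" unfolding \<rho>_def using U'i Ui mat_rem_cmat by simp
    have MA: "cmat M ** char_matrix A = char_matrix B ** cmat M"
      using char_matrix_cmat_commute[of M A B] that by (simp add: cmat_def vec_eq_iff)
    have "?Q ** ?D = U' ** cmat M ** (Ui ** ?D)" by (simp only: matrix_mul_assoc)
    also have "\<dots> = U' ** (cmat M ** char_matrix A) ** V" unfolding UiD by (simp only: matrix_mul_assoc)
    also have "\<dots> = (U' ** char_matrix B) ** cmat M ** V" unfolding MA by (simp only: matrix_mul_assoc)
    also have "\<dots> = ?D' ** (V'i ** cmat M ** V)" unfolding U'B by (simp only: matrix_mul_assoc)
    finally have "(?Q ** ?D) $ i $ j = (?D' ** (V'i ** cmat M ** V)) $ i $ j" for i j by (rule arg_cong)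
    then have "?Q $ i $ j * d j = d' i * (V'i ** cmat M ** V) $ i $ j" for i j
      unfolding diag_mult_left diag_mult_right .
    then show "f i j dvd ?Q $ i $ j" for i j using f by (metis dvd_triv_left)
  qed
  \<comment> \<open>Normal form of the entries: f times a polynomial of degree below that of g, as
    multiples of d' = f g are killed. Its coefficients are free, one for each triple in
    \<open>I\<close>.\<close>
  define p where "p c i j = (\<Sum>k<degree (g i j). monom (c (i, j, k)) k)" for c :: "'n \<times> 'n \<times> nat \<Rightarrow> real" and i j
  define Q where "Q c = (\<chi> i j. f i j * p c i j)" for c
  define I where "I = Sigma UNIV (\<lambda>i. Sigma UNIV (\<lambda>j. {..<degree (g i j)}))"
  have g0: "g i j \<noteq> 0" "f i j \<noteq> 0" for i j using d' by (metis mult_zero_left mult_zero_right)+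
  have p_dvd: "g i j dvd p c i j \<longleftrightarrow> (\<forall>k<degree (g i j). c (i, j, k) = 0)" for c i j
  proof
    assume dv: "g i j dvd p c i j"
    have "p c i j = 0"
    proof (rule ccontr)
      assume nz: "p c i j \<noteq> 0"
      then have "degree (g i j) \<le> degree (p c i j)" using dv dvd_imp_degree_le by blast
      then have "coeff (p c i j) (degree (p c i j)) = 0" unfolding p_def coeff_sum_monom by simp
      then show False using nz by simp
    qed
    then show "\<forall>k<degree (g i j). c (i, j, k) = 0"
      using coeff_sum_monom[of "\<lambda>k. c (i, j, k)" "degree (g i j)"] unfolding p_def by (metis coeff_0)
  qed (simp add: p_def)
  have "dim (range (\<lambda>c. \<rho> (Q c))) = card I"
  proof (rule dim_range_linear_param)
    show "finite I" unfolding I_def by (intro finite_SigmaI) auto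
    show "\<rho> (Q (\<lambda>t. c t + c' t)) = \<rho> (Q c) + \<rho> (Q c')" for c c'
      unfolding \<rho>_add[symmetric]
      by (simp add: Q_def p_def vec_eq_iff add_monom[symmetric] sum.distrib distrib_left plus_vec_def)
    show "\<rho> (Q (\<lambda>t. r * c t)) = r *\<^sub>R \<rho> (Q c)" for r c
    proof -
      have "p (\<lambda>t. r * c t) i j = [:r:] * p c i j" for i j
        by (simp add: p_def sum_distrib_left smult_monom)
      then have "Q (\<lambda>t. r * c t) = mat [:r:] ** Q c"
        by (simp add: Q_def vec_eq_iff mat_mult_left mult.left_commute)
      then show ?thesis by (simp only: \<rho>_scale)
    qed
    show "\<rho> (Q c) = 0 \<longleftrightarrow> (\<forall>t\<in>I. c t = 0)" for c
    proof -
      have "d' i dvd f i j * p c i j \<longleftrightarrow> g i j dvd p c i j" for i j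
        unfolding d'(1)[of i j] using g0 by simp
      then have "\<rho> (Q c) = 0 \<longleftrightarrow> (\<forall>i j. g i j dvd p c i j)"
        unfolding \<rho>_0 by (simp add: Q_def)
      then show ?thesis unfolding p_dvd I_def by auto
    qed
  qed
  moreover have "range (\<lambda>c. \<rho> (Q c)) = {M. B ** M = M ** A}"
  proof (intro equalityI subsetI)
    fix M assume "M \<in> range (\<lambda>c. \<rho> (Q c))"
    then show "M \<in> {M. B ** M = M ** A}" using \<rho>_intertwines by (auto simp: Q_def)
  next
    fix M assume "M \<in> {M. B ** M = M ** A}"
    then obtain P where P: "\<rho> P = M" "\<And>i j. f i j dvd P $ i $ j" using \<rho>_onto by blast
    define q where "q i j = P $ i $ j div f i j" for i j
    have q: "P $ i $ j = f i j * q i j" for i j using P(2) by (simp add: q_def)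
    \<comment> \<open>The cofactor is reduced modulo g; the part discarded contributes a multiple of
      \<open>d' i\<close>.\<close>
    define c where "c t = (case t of (i, j, k) \<Rightarrow> coeff (q i j mod g i j) k)" for t
    have "p c i j = q i j mod g i j" for i j
    proof (rule poly_eqI)
      fix k
      have "coeff (q i j mod g i j) k = 0" if "\<not> k < degree (g i j)"
        using degree_mod_less[OF g0(1), of "q i j"] that by (metis coeff_0 coeff_eq_0 leI less_le_trans)
      then show "coeff (p c i j) k = coeff (q i j mod g i j) k"
        unfolding p_def coeff_sum_monom by (simp add: c_def)
    qed
    then have "(P - Q c) $ i $ j = d' i * (q i j div g i j)" for i j
      unfolding Q_def d'(1)[of i j] vector_minus_component q
      by (simp add: right_diff_distrib[symmetric] mult.assoc) (simp add: minus_mod_eq_mult_div)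
    then have "\<rho> (P - Q c) = 0" unfolding \<rho>_0 by simp
    then have "\<rho> (Q c) = M" using P(1) \<rho>_diff by simp
    then show "M \<in> range (\<lambda>c. \<rho> (Q c))" by blast
  qed
  moreover have "card I = (\<Sum>i\<in>UNIV. \<Sum>j\<in>UNIV. degree (g i j))" by (simp add: I_def)
  ultimately show ?thesis by simp
qed

text \<open>Exactly 2 (n - l) + 1 pairs have minimum l; reversing the order of l gives the weights 2
  k - 1.\<close>

lemma sum_min:
  fixes w :: "nat \<Rightarrow> int"
  shows "(\<Sum>a=1..n. \<Sum>b=1..n. w (min a b)) = (\<Sum>k=1..n. (2 * int k - 1) * w (n - k + 1))"
proof -
  have "(\<Sum>a=1..n. \<Sum>b=1..n. w (min a b)) = (\<Sum>l=1..n. (2 * int (n - l) + 1) * w l)"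
  proof (induction n)
    case (Suc n)
    have "(\<Sum>a=1..Suc n. \<Sum>b=1..Suc n. w (min a b)) =
        (\<Sum>a=1..n. (\<Sum>b=1..n. w (min a b)) + w (min a (Suc n))) + ((\<Sum>b=1..n. w (min (Suc n) b)) + w (Suc n))"
      by simp
    also have "(\<Sum>b=1..n. w (min (Suc n) b)) = (\<Sum>b=1..n. w b)" by (rule sum.cong) (auto simp: min_def)
    also have "(\<Sum>a=1..n. (\<Sum>b=1..n. w (min a b)) + w (min a (Suc n))) =
        (\<Sum>a=1..n. \<Sum>b=1..n. w (min a b)) + (\<Sum>b=1..n. w b)"
      unfolding sum.distrib by (intro arg_cong2[where f="(+)"] refl sum.cong) (auto simp: min_def)
    also have "\<dots> + ((\<Sum>b=1..n. w b) + w (Suc n)) =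
        (\<Sum>l=1..n. (2 * int (n - l) + 1) * w l + 2 * w l) + w (Suc n)"
      unfolding Suc by (simp add: sum.distrib sum_distrib_left[symmetric])
    also have "(\<Sum>l=1..n. (2 * int (n - l) + 1) * w l + 2 * w l) = (\<Sum>l=1..n. (2 * int (Suc n - l) + 1) * w l)"
      by (rule sum.cong) (auto simp: Suc_diff_le algebra_simps)
    finally show ?case by simp
  qed simp
  also have "\<dots> = (\<Sum>k=1..n. (2 * int k - 1) * w (n - k + 1))"
    by (rule sum.reindex_bij_witness[of _ "\<lambda>k. n - k + 1" "\<lambda>k. n - k + 1"]) (auto simp: of_nat_diff)
  finally show ?thesis .
qed

text \<open>In a divisibility chain the gcd of two members is the one of smaller index, whence the
  minimum. The diagonals of A and B may be numbered differently; summing over all pairs removes this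
  dependence.\<close>

theorem dim_intertwiners_invariant_polynomials:
  fixes A B :: "real^'n^'n"
  assumes "has_invariant_polynomials A \<alpha>" "has_invariant_polynomials B \<alpha>"
  shows "int (dim {M. B ** M = M ** A}) =
    (\<Sum>k = 1..CARD('n). (2 * int k - 1) * int (degree (\<alpha> (CARD('n) - k + 1))))"
proof -
  let ?n = "CARD('n)"
  have monic: "\<alpha> i \<noteq> 0" if "i \<in> {1..?n}" for i
    using assms(1) that unfolding has_invariant_polynomials_def by fastforce
  have dvd: "\<alpha> i dvd \<alpha> j" if "1 \<le> i" "i \<le> j" "j \<le> ?n" for i j
    using that(2,3)
  proof (induction j rule: dec_induct)
    case (step j)
    then have "j \<in> {1..<?n}" using that(1) by auto
    then show ?case using assms(1) step unfolding has_invariant_polynomials_def by (auto intro: dvd_trans)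
  qed simp
  obtain e e' :: "'n \<Rightarrow> nat" where e: "bij_betw e UNIV {1..?n}" "bij_betw e' UNIV {1..?n}"
    and eq: "unimod_equiv (char_matrix A) (\<chi> i j. if i = j then \<alpha> (e i) else 0)"
      "unimod_equiv (char_matrix B) (\<chi> i j. if i = j then \<alpha> (e' i) else 0)"
    using assms unfolding has_invariant_polynomials_iff by blast
  have range: "e i \<in> {1..?n}" "e' i \<in> {1..?n}" for i using e unfolding bij_betw_def by blast+
  define g where "g i j = \<alpha> (min (e' i) (e j))" for i j
  have "dim {M. B ** M = M ** A} = (\<Sum>i\<in>UNIV. \<Sum>j\<in>UNIV. degree (g i j))"
  proof (rule dim_intertwiners[OF eq, of "\<lambda>i j. \<alpha> (e' i) div g i j"])
    fix i j :: 'n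
    have g_dvd: "g i j dvd \<alpha> (e' i)" unfolding g_def using range[of i] range[of j] by (intro dvd) auto
    then show "\<alpha> (e' i) = \<alpha> (e' i) div g i j * g i j" by simp
    show "\<alpha> (e' i) \<noteq> 0" using monic range by blast
    show "\<alpha> (e' i) dvd q * \<alpha> (e j) \<longleftrightarrow> \<alpha> (e' i) div g i j dvd q" for q
    proof (cases "e' i \<le> e j")
      case True
      then have "\<alpha> (e' i) dvd \<alpha> (e j)" using range[of i] range[of j] by (intro dvd) auto
      moreover have "\<alpha> (e' i) div g i j = 1" using True monic range[of i] by (simp add: g_def)
      ultimately show ?thesis by simp
    next
      case False
      then have "g i j = \<alpha> (e j)" by (simp add: g_def)
      then show ?thesis using g_dvd monic[OF range(1)[of j]]
        by (metis dvd_div_mult_self dvd_mult_cancel_right)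
    qed
  qed
  also have "int \<dots> = (\<Sum>a=1..?n. \<Sum>b=1..?n. int (degree (\<alpha> (min a b))))"
    unfolding g_def of_nat_sum
    using sum.reindex_bij_betw[OF e(2), of "\<lambda>a. \<Sum>j\<in>UNIV. int (degree (\<alpha> (min a (e j))))"]
      sum.reindex_bij_betw[OF e(1), of "\<lambda>b. int (degree (\<alpha> (min _ b)))"] by simp
  finally show ?thesis unfolding sum_min[of "\<lambda>l. int (degree (\<alpha> l))"] .
qed

section \<open>Smoothness and transversality\<close>

lemma Ck_on_cong:
  assumes "open W" "\<And>x. x \<in> W \<Longrightarrow> f x = g x" "Ck_on k f W"
  shows "Ck_on k g W"
  using assms(2,3)
proof (induction k arbitrary: f g)
  case 0
  then show ?case by (simp cong: continuous_on_cong)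
next
  case (Suc k)
  have der: "(g has_derivative frechet_derivative f (at x)) (at x)" if "x \<in> W" for x
  proof (rule has_derivative_transform_within_open[OF _ assms(1) that])
    show "(f has_derivative frechet_derivative f (at x)) (at x)"
      using Suc.prems(2) that frechet_derivative_works by auto
  qed (use Suc.prems in simp)
  have "Ck_on k (\<lambda>x. frechet_derivative g (at x) v) W" for v
  proof (rule Suc.IH)
    show "Ck_on k (\<lambda>x. frechet_derivative f (at x) v) W" using Suc.prems by simp
  qed (use frechet_derivative_at[OF der] in simp)
  then show ?case using der by (auto simp: differentiable_def)
qed

text \<open>On an open set derivatives are unique, so any explicit formula may stand in for the
  chosen \<open>frechet_derivative\<close> in the recursion.\<close>

lemma Ck_on_SucI:
  assumes "open W" "\<And>x. x \<in> W \<Longrightarrow> (f has_derivative f' x) (at x)" "\<And>v. Ck_on k (\<lambda>x. f' x v) W"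
  shows "Ck_on (Suc k) f W"
proof -
  have "Ck_on k (\<lambda>x. frechet_derivative f (at x) v) W" for v
    by (rule Ck_on_cong[OF assms(1) _ assms(3)[of v]]) (use frechet_derivative_at[OF assms(2)] in simp)
  then show ?thesis using assms(2) by (auto simp: differentiable_def)
qed

lemma Ck_on_SucD:
  assumes "Ck_on (Suc k) f W"
  shows "Ck_on k f W"
  using assms
proof (induction k arbitrary: f)
  case 0
  then have "\<forall>x\<in>W. f differentiable (at x)" by simp
  then show ?case by (simp add: continuous_at_imp_continuous_on differentiable_imp_continuous_within)
qed simp

lemma Ck_on_const: "Ck_on k (\<lambda>_. c) W"
  by (induction k arbitrary: c) simp_all

lemma Ck_on_bounded_linear:
  assumes "open W" "bounded_linear f"
  shows "Ck_on k f W"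
proof (cases k)
  case 0
  then show ?thesis using assms by (simp add: linear_continuous_on)
next
  case (Suc j)
  then show ?thesis
    using Ck_on_SucI[OF assms(1) bounded_linear_imp_has_derivative[OF assms(2)] Ck_on_const] by simp
qed

lemma Ck_on_add:
  assumes "open W" "Ck_on k f W" "Ck_on k g W"
  shows "Ck_on k (\<lambda>x. f x + g x) W"
  using assms(2,3)
proof (induction k arbitrary: f g)
  case 0
  then show ?case by (simp add: continuous_on_add)
next
  case (Suc k)
  show ?case
  proof (rule Ck_on_SucI[OF assms(1)])
    fix x assume "x \<in> W"
    then show "((\<lambda>x. f x + g x) has_derivative (\<lambda>v. frechet_derivative f (at x) v + frechet_derivative g (at x) v)) (at x)"
      using Suc.prems by (intro has_derivative_add frechet_derivative_works[THEN iffD1]) auto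
  next
    show "Ck_on k (\<lambda>x. frechet_derivative f (at x) v + frechet_derivative g (at x) v) W" for v
      using Suc by simp
  qed
qed

lemma Ck_on_bilinear:
  assumes "open W" "bounded_bilinear h" "Ck_on k f W" "Ck_on k g W"
  shows "Ck_on k (\<lambda>x. h (f x) (g x)) W"
  using assms(3,4)
proof (induction k arbitrary: f g)
  case 0
  then show ?case using bounded_bilinear.continuous_on[OF assms(2)] by simp
next
  case (Suc k)
  show ?case
  proof (rule Ck_on_SucI[OF assms(1)])
    fix x assume "x \<in> W"
    then show "((\<lambda>x. h (f x) (g x)) has_derivative
        (\<lambda>v. h (f x) (frechet_derivative g (at x) v) + h (frechet_derivative f (at x) v) (g x))) (at x)"
      using Suc.prems by (intro bounded_bilinear.FDERIV[OF assms(2)] frechet_derivative_works[THEN iffD1]) auto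
  next
    show "Ck_on k (\<lambda>x. h (f x) (frechet_derivative g (at x) v) + h (frechet_derivative f (at x) v) (g x)) W" for v
      using Suc.prems Ck_on_SucD[OF Suc.prems(1)] Ck_on_SucD[OF Suc.prems(2)]
      by (intro Ck_on_add[OF assms(1)] Suc.IH) simp_all
  qed
qed

lemma bounded_bilinear_matrix_mult:
  "bounded_bilinear ((**) :: real^'n^'m \<Rightarrow> real^'p^'n \<Rightarrow> real^'p^'m)"
  unfolding bilinear_conv_bounded_bilinear[symmetric] bilinear_def
  by (auto intro!: linearI simp: matrix_add_ldistrib matrix_add_rdistrib matrix_scalar_ac scalar_matrix_assoc)

lemma linear_matrix_mult_left: "linear (\<lambda>X. (A :: real^'n^'m) ** (X :: real^'p^'n))"
  using bounded_bilinear.bounded_linear_right[OF bounded_bilinear_matrix_mult] bounded_linear.linear by blast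

lemma linear_matrix_mult_right: "linear (\<lambda>X. (X :: real^'n^'m) ** (B :: real^'p^'n))"
  using bounded_bilinear.bounded_linear_left[OF bounded_bilinear_matrix_mult] bounded_linear.linear by blast

section \<open>Smoothness of the inverse of I - \<eta>(x)\<close>

lemma matrix_inv_mult:
  fixes A :: "real^'n^'n"
  assumes "det A \<noteq> 0"
  shows "A ** matrix_inv A = mat 1" "matrix_inv A ** A = mat 1"
proof -
  have "invertible A" using assms by (simp add: invertible_det_nz)
  then have "A ** matrix_inv A = mat 1 \<and> matrix_inv A ** A = mat 1"
    unfolding invertible_def matrix_inv_def by (rule someI_ex)
  then show "A ** matrix_inv A = mat 1" "matrix_inv A ** A = mat 1" by auto
qed

lemma open_det_nonzero: 
  assumes "continuous_on S f" "open S"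
  shows "open {x \<in> S. det (f x :: real^'n^'n) \<noteq> 0}"
proof -
  have "continuous_on S (\<lambda>x. det (f x))"
    unfolding det_def by (intro continuous_intros assms(1))
  then have "open (S \<inter> (\<lambda>x. det (f x)) -` (- {0}))"
    using assms(2) by (rule continuous_open_preimage) auto
  moreover have "S \<inter> (\<lambda>x. det (f x)) -` (- {0}) = {x \<in> S. det (f x) \<noteq> 0}" by auto
  ultimately show ?thesis by simp
qed

context
  fixes \<eta> :: "'a::euclidean_space \<Rightarrow> real^'n^'n" and N :: "'a \<Rightarrow> real^'n^'n" and W :: "'a set"
  assumes \<eta>: "bounded_linear \<eta>" and W: "open W"
    and N: "\<And>x. x \<in> W \<Longrightarrow> (mat 1 - \<eta> x) ** N x = mat 1"
begin

text \<open>Both continuity and the derivative of the inverse are read off from this identity,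
  without expressing its entries by determinants.\<close>

lemma resolvent_identity:
  assumes "x \<in> W" "y \<in> W"
  shows "N y - N x = N y ** \<eta> (y - x) ** N x"
proof -
  have Ny: "N y ** (mat 1 - \<eta> y) = mat 1" using N[OF assms(2)] matrix_left_right_inverse by blast
  have "N y - N x = N y ** ((mat 1 - \<eta> x) ** N x) - (N y ** (mat 1 - \<eta> y)) ** N x"
    using N[OF assms(1)] Ny by simp
  also have "\<dots> = N y ** ((mat 1 - \<eta> x) - (mat 1 - \<eta> y)) ** N x"
    by (simp only: matrix_mul_assoc matrix_diff_ldistrib matrix_diff_rdistrib)
  also have "(mat 1 - \<eta> x) - (mat 1 - \<eta> y) = \<eta> (y - x)"
    using linear_diff[OF bounded_linear.linear[OF \<eta>]] by simp
  finally show ?thesis .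
qed

lemma resolvent_continuous: "continuous_on W N"
proof -
  interpret M: bounded_bilinear "(**) :: real^'n^'n \<Rightarrow> real^'n^'n \<Rightarrow> real^'n^'n"
    by (rule bounded_bilinear_matrix_mult)
  obtain C where C: "C > 0" "\<And>(A :: real^'n^'n) (B :: real^'n^'n). norm (A ** B) \<le> norm A * norm B * C"
    using M.pos_bounded by blast
  have "isCont N x" if x: "x \<in> W" for x
  proof -
    define u where "u y = norm (\<eta> (y - x)) * norm (N x) * C * C" for y
    have u0: "(u \<longlongrightarrow> 0) (at x)"
    proof -
      have "isCont u x" unfolding u_def
        by (intro continuous_intros bounded_linear.isCont[OF \<eta>])
      then show ?thesis using linear_0[OF bounded_linear.linear[OF \<eta>]] by (simp add: isCont_def u_def)
    qed
    \<comment> \<open>This bound still contains \<open>N y\<close>. Once u y < 1/2 it can be solved,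
      giving norm (N y) at most twice norm (N x).\<close>
    have bound: "norm (N y - N x) \<le> norm (N y) * u y" if "y \<in> W" for y
    proof -
      have "norm (N y - N x) \<le> norm (N y ** \<eta> (y - x)) * norm (N x) * C"
        unfolding resolvent_identity[OF x that] by (rule C)
      also have "\<dots> \<le> (norm (N y) * norm (\<eta> (y - x)) * C) * norm (N x) * C"
        using C by (intro mult_right_mono) auto
      finally show ?thesis by (simp add: u_def mult_ac)
    qed
    have "\<forall>\<^sub>F y in at x. u y < 1/2" using u0 by (rule order_tendstoD) simp
    moreover have "\<forall>\<^sub>F y in at x. y \<in> W" using W x eventually_at_topological by blast
    ultimately have "\<forall>\<^sub>F y in at x. norm (N y - N x) \<le> 2 * norm (N x) * u y"
    proof eventually_elim
      case (elim y)
      have u_nonneg: "0 \<le> u y" using C(1) by (simp add: u_def)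
      have "norm (N y) \<le> norm (N x) + norm (N y - N x)" by (rule norm_triangle_sub)
      moreover have "norm (N y) * u y \<le> norm (N y) * (1/2)" using elim(1) by (intro mult_left_mono) auto
      ultimately have "norm (N y) \<le> 2 * norm (N x)" using bound[OF elim(2)] by linarith
      from mult_right_mono[OF this u_nonneg] show ?case using bound[OF elim(2)] by linarith
    qed
    moreover have "((\<lambda>y. 2 * norm (N x) * u y) \<longlongrightarrow> 0) (at x)" using u0 by (rule tendsto_mult_right_zero)
    ultimately have "((\<lambda>y. N y - N x) \<longlongrightarrow> 0) (at x)" by (rule Lim_null_comparison)
    then show ?thesis by (simp add: isCont_def LIM_zero_iff)
  qed
  then show ?thesis by (simp add: continuous_at_imp_continuous_on)
qed

lemma resolvent_derivative:
  assumes x: "x \<in> W"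
  shows "(N has_derivative (\<lambda>v. N x ** \<eta> v ** N x)) (at x)"
proof (rule has_derivativeI)
  interpret M: bounded_bilinear "(**) :: real^'n^'n \<Rightarrow> real^'n^'n \<Rightarrow> real^'n^'n"
    by (rule bounded_bilinear_matrix_mult)
  show "bounded_linear (\<lambda>v. N x ** \<eta> v ** N x)"
    by (intro bounded_linear_compose[OF M.bounded_linear_left] bounded_linear_compose[OF M.bounded_linear_right] \<eta>)
  obtain C where C: "C > 0" "\<And>(A :: real^'n^'n) (B :: real^'n^'n). norm (A ** B) \<le> norm A * norm B * C"
    using M.pos_bounded by blast
  obtain B where B: "B > 0" "\<And>v. norm (\<eta> v) \<le> norm v * B"
    using bounded_linear.pos_bounded[OF \<eta>] by blast
  have "norm ((N y - N x - N x ** \<eta> (y - x) ** N x) /\<^sub>R norm (y - x)) \<le> norm (N y - N x) * (B * C * norm (N x) * C)"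
    if "y \<in> W" for y
  proof (cases "y = x")
    case False
    have "(N y - N x) ** \<eta> (y - x) ** N x = N y ** \<eta> (y - x) ** N x - N x ** \<eta> (y - x) ** N x"
      by (simp only: matrix_diff_rdistrib)
    then have "N y - N x - N x ** \<eta> (y - x) ** N x = (N y - N x) ** \<eta> (y - x) ** N x"
      by (simp only: resolvent_identity[OF x that, symmetric])
    then have "norm (N y - N x - N x ** \<eta> (y - x) ** N x) \<le> norm ((N y - N x) ** \<eta> (y - x)) * norm (N x) * C"
      using C(2)[of "(N y - N x) ** \<eta> (y - x)" "N x"] by (simp only:)
    also have "\<dots> \<le> (norm (N y - N x) * norm (\<eta> (y - x)) * C) * norm (N x) * C"
      using C by (intro mult_right_mono) auto
    also have "\<dots> \<le> (norm (N y - N x) * (norm (y - x) * B) * C) * norm (N x) * C"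
      using C B(2) by (intro mult_right_mono mult_left_mono) auto
    finally have le: "norm (N y - N x - N x ** \<eta> (y - x) ** N x)
        \<le> norm (N y - N x) * (B * C * norm (N x) * C) * norm (y - x)" by (simp add: mult_ac)
    have "norm ((N y - N x - N x ** \<eta> (y - x) ** N x) /\<^sub>R norm (y - x)) =
        norm (N y - N x - N x ** \<eta> (y - x) ** N x) / norm (y - x)"
      by (simp only: norm_scaleR) (simp add: divide_inverse mult.commute)
    also have "\<dots> \<le> norm (N y - N x) * (B * C * norm (N x) * C)"
      using le False by (simp add: pos_divide_le_eq)
    finally show ?thesis .
  qed (use B C in simp)
  then have "\<forall>\<^sub>F y in at x. norm ((N y - N x - N x ** \<eta> (y - x) ** N x) /\<^sub>R norm (y - x))
      \<le> norm (N y - N x) * (B * C * norm (N x) * C)"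
    using W x eventually_at_topological by blast
  moreover have "((\<lambda>y. norm (N y - N x) * (B * C * norm (N x) * C)) \<longlongrightarrow> 0) (at x)"
  proof (rule tendsto_mult_left_zero, rule tendsto_norm_zero)
    have "isCont N x" using resolvent_continuous W x by (simp add: continuous_on_eq_continuous_at)
    then show "((\<lambda>y. N y - N x) \<longlongrightarrow> 0) (at x)" by (simp add: isCont_def LIM_zero)
  qed
  ultimately show "((\<lambda>y. (N y - N x - N x ** \<eta> (y - x) ** N x) /\<^sub>R norm (y - x)) \<longlongrightarrow> 0) (at x)"
    by (rule Lim_null_comparison)
qed

text \<open>The derivative in direction v is a product of two copies of N with the linear term
  \<eta> v, which is constant in x, so each order of smoothness yields the next.\<close>

lemma Ck_on_resolvent: "Ck_on k N W"
proof (induction k)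
  case 0
  show ?case using resolvent_continuous by simp
next
  case (Suc k)
  show ?case
    by (rule Ck_on_SucI[OF W resolvent_derivative])
      (assumption, intro Ck_on_bilinear[OF W bounded_bilinear_matrix_mult] Suc Ck_on_const)
qed

end

section \<open>Rank and nullity, adjoints, transversality\<close>

lemma dim_image_plus_dim_kernel:
  fixes f :: "'a::euclidean_space \<Rightarrow> 'b::euclidean_space"
  assumes "linear f" "subspace S"
  shows "dim (f ` S) + dim {x \<in> S. f x = 0} = dim S"
proof -
  define P where "P = {x \<in> S. f x = 0}"
  define C where "C = {y \<in> S. \<forall>x\<in>P. orthogonal x y}"
  have P: "subspace P"
    unfolding P_def subspace_def using assms
    by (auto simp: subspace_0 subspace_add subspace_scale linear_0 linear_add linear_scale)
  have C: "subspace C"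
    unfolding C_def subspace_def using assms(2)
    by (auto simp: orthogonal_def inner_right_distrib subspace_0 subspace_add subspace_scale)
  have dim: "dim C + dim P = dim S"
    unfolding C_def by (rule dim_subspace_orthogonal_to_vectors) (use P assms in \<open>auto simp: P_def\<close>)
  have "inj_on f C"
    unfolding linear_inj_on_iff_eq_0[OF assms(1) C]
  proof (intro ballI impI)
    fix x assume "x \<in> C" "f x = 0"
    then have "x \<in> P" "\<forall>y\<in>P. orthogonal y x" unfolding C_def P_def by auto
    then show "x = 0" by (auto simp: orthogonal_def)
  qed
  then have "dim (f ` C) = dim C" using dim_image_eq[OF assms(1)] C by (metis span_eq_iff)
  moreover have "f ` S = f ` C"
  proof
    show "f ` C \<subseteq> f ` S" unfolding C_def by auto
    show "f ` S \<subseteq> f ` C"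
    proof
      fix z assume "z \<in> f ` S"
      then obtain y where y: "y \<in> S" "z = f y" by auto
      obtain p q where pq: "y = p + q" "p \<in> span P" "\<And>w. w \<in> span P \<Longrightarrow> orthogonal q w"
        using orthogonal_subspace_decomp_exists[of P y] by metis
      have p: "p \<in> P" using pq(2) P span_eq_iff by blast
      have "q = y - p" using pq(1) by simp
      then have "q \<in> S" using y(1) p subspace_diff[OF assms(2)] unfolding P_def by blast
      then have "q \<in> C" unfolding C_def using pq(3) span_base orthogonal_commute by blast
      moreover have "f y = f q" using pq(1) p linear_add[OF assms(1)] by (simp add: P_def)
      ultimately show "z \<in> f ` C" using y by auto
    qed
  qed
  ultimately show ?thesis using dim unfolding P_def by simp
qed

lemma inner_matrix_mult_left: "Z \<bullet> (A ** X) = (transpose A ** Z) \<bullet> X" 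
  for A :: "real^'n^'m" and X :: "real^'k^'n"
proof -
  have "Z \<bullet> (A ** X) = (\<Sum>i\<in>UNIV. \<Sum>j\<in>UNIV. \<Sum>t\<in>UNIV. A $ i $ t * Z $ i $ j * X $ t $ j)"
    by (simp add: inner_vec_def matrix_matrix_mult_def sum_distrib_left mult_ac)
  also have "\<dots> = (\<Sum>i\<in>UNIV. \<Sum>t\<in>UNIV. \<Sum>j\<in>UNIV. A $ i $ t * Z $ i $ j * X $ t $ j)"
    by (intro sum.cong refl sum.swap)
  also have "\<dots> = (\<Sum>t\<in>UNIV. \<Sum>i\<in>UNIV. \<Sum>j\<in>UNIV. A $ i $ t * Z $ i $ j * X $ t $ j)" by (rule sum.swap)
  also have "\<dots> = (\<Sum>t\<in>UNIV. \<Sum>j\<in>UNIV. \<Sum>i\<in>UNIV. A $ i $ t * Z $ i $ j * X $ t $ j)"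
    by (intro sum.cong refl sum.swap)
  also have "\<dots> = (transpose A ** Z) \<bullet> X"
    by (simp add: inner_vec_def matrix_matrix_mult_def transpose_def sum_distrib_right)
  finally show ?thesis .
qed

lemma inner_transpose: "transpose A \<bullet> transpose B = A \<bullet> (B :: real^'n^'m)"
  by (simp add: inner_vec_def transpose_def) (rule sum.swap)

lemma inner_matrix_mult_right: "Z \<bullet> (X ** A) = (Z ** transpose A) \<bullet> X" 
  for A :: "real^'n^'m" and X :: "real^'m^'k"
proof -
  have "Z \<bullet> (X ** A) = transpose Z \<bullet> (transpose A ** transpose X)"
    by (simp only: inner_transpose[symmetric, of Z] matrix_transpose_mul)
  also have "\<dots> = (A ** transpose Z) \<bullet> transpose X" by (simp add: inner_matrix_mult_left)
  also have "\<dots> = transpose (A ** transpose Z) \<bullet> X" by (metis inner_transpose transpose_transpose)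
  finally show ?thesis by (simp add: matrix_transpose_mul)
qed

text \<open>Transversality of the affine space of closed loop matrices to the similarity orbit of \<open>A\<close>: an
  annihilator \<open>Z\<close> commutes with the transpose of \<open>A\<close> and vanishes on the range of \<open>G\<close>, hence on all
  reachable vectors.\<close>

lemma controllable_transversal:
  fixes A :: "real^'n^'n" and G :: "real^'m^'n"
  assumes "controllable A G"
  shows "{B + C |B C. B \<in> range (\<lambda>Y. G ** Y) \<and> C \<in> range (\<lambda>X. A ** X - X ** A)} = UNIV" (is "?S = UNIV")
proof (rule ccontr)
  assume "?S \<noteq> UNIV"
  have l1: "linear (\<lambda>Y. G ** (Y :: real^'n^'m))" by (rule linear_matrix_mult_left)
  have l2: "linear (\<lambda>X. A ** X - X ** A)"
    by (intro linear_compose_sub linear_matrix_mult_left linear_matrix_mult_right)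
  have sub: "subspace ?S"
    by (intro subspace_sums linear_subspace_image[OF l1] linear_subspace_image[OF l2] subspace_UNIV)
  then have "span ?S = ?S" by (simp only: span_eq_iff)
  then have "dim ?S \<noteq> DIM(real^'n^'n)" using \<open>?S \<noteq> UNIV\<close> by (simp only: dim_eq_full) simp
  then have "dim ?S < DIM(real^'n^'n)" using dim_subset_UNIV[of ?S] by linarith
  then obtain Z where Z: "Z \<noteq> 0" "\<And>B. B \<in> span ?S \<Longrightarrow> orthogonal Z B"
    using orthogonal_to_subspace_exists by blast
  have orth: "Z \<bullet> B = 0" if "B \<in> ?S" for B
    using Z(2)[OF span_base[OF that]] by (simp add: orthogonal_def)
  have "(transpose G ** Z) \<bullet> Y = 0" for Y
  proof -
    have "G ** Y + (A ** 0 - 0 ** A) \<in> ?S" by blast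
    from orth[OF this] show ?thesis by (simp add: inner_matrix_mult_left[symmetric])
  qed
  then have GZ: "transpose G ** Z = 0" by (metis inner_eq_zero_iff)
  have "(transpose A ** Z - Z ** transpose A) \<bullet> X = 0" for X
  proof -
    have "G ** 0 + (A ** X - X ** A) \<in> ?S" by blast
    from orth[OF this] show ?thesis
      by (simp add: inner_diff_left inner_diff_right inner_matrix_mult_left[symmetric] inner_matrix_mult_right[symmetric])
  qed
  then have AZ: "transpose A ** Z = Z ** transpose A" by (metis inner_eq_zero_iff right_minus_eq)
  have ZG: "transpose Z ** G = 0"
    using arg_cong[OF GZ, of transpose] by (simp add: matrix_transpose_mul) (simp add: transpose_def vec_eq_iff)
  have ZA: "transpose Z ** A = A ** transpose Z"
    using arg_cong[OF AZ, of transpose] by (simp add: matrix_transpose_mul)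
  have "transpose Z *v x = 0" if "x \<in> reach ((*v) A) (span (columns G)) i" for x i
    using that
  proof (induction i arbitrary: x)
    case (Suc i)
    then obtain a y where x: "x = a + A *v y" "a \<in> span (columns G)" "y \<in> reach ((*v) A) (span (columns G)) i"
      by auto
    obtain b where "a = G *v b" using x(2) unfolding span_columns by blast
    then have "transpose Z *v a = 0" using ZG by (simp add: matrix_vector_mul_assoc)
    moreover have "transpose Z *v (A *v y) = A *v (transpose Z *v y)"
      by (simp only: matrix_vector_mul_assoc ZA)
    ultimately show ?case using x Suc.IH by (simp add: matrix_vector_right_distrib)
  qed simp
  then have "transpose Z *v x = 0" for x using assms unfolding controllable_reach by blast
  then have "transpose Z = 0" by (simp add: matrix_eq)
  then have "Z = 0" by (simp add: transpose_def vec_eq_iff)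
  then show False using Z(1) by simp
qed

lemma controllable_feedback:
  assumes "controllable F G"
  shows "controllable (F + G ** K) G"
proof -
  have "F *v x - (F + G ** K) *v x = G *v (- (K *v x))" for x
    by (simp add: matrix_vector_mult_add_rdistrib matrix_vector_mul_assoc[symmetric] vec.neg)
  then have "F *v x - (F + G ** K) *v x \<in> span (columns G)" for x
    unfolding span_columns by blast
  then have "reach ((*v) F) (span (columns G)) i \<subseteq> reach ((*v) (F + G ** K)) (span (columns G)) i" for i
    by (intro reach_perturb) auto
  then show ?thesis using assms unfolding controllable_reach by blast
qed

section \<open>Local parametrizations\<close>

lemma second_countable_euclidean: "second_countable (euclidean :: 'a::second_countable_topology topology)"
proof -
  obtain B :: "'a set set" where B: "countable B" "topological_basis B" using ex_countable_basis by blast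
  have "\<forall>V\<in>B. openin euclidean V" using topological_basis_open[OF B(2)] by simp
  moreover have "\<exists>V\<in>B. x \<in> V \<and> V \<subseteq> U" if "openin euclidean U" "x \<in> U" for U and x :: 'a
    using topological_basisE[OF B(2), of U x] that by (metis open_openin)
  ultimately show ?thesis unfolding second_countable_def using B(1) by blast
qed

text \<open>Chart images that are relatively open and have continuous inverses allow the subspace
  topology as T, so such a set is even embedded.\<close>

lemma immersed_submanifoldI:
  fixes S :: "'a::euclidean_space set"
  assumes "\<And>p. p \<in> S \<Longrightarrow> \<exists>L W (\<phi> :: 'a \<Rightarrow> 'a) \<psi> U.
      subspace L \<and> dim L = d \<and> smooth_on \<phi> W \<and> (\<forall>x\<in>W \<inter> L. inj_on (frechet_derivative \<phi> (at x)) L) \<and>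
      open U \<and> p \<in> U \<and> \<phi> ` (W \<inter> L) = S \<inter> U \<and> continuous_on U \<psi> \<and> (\<forall>x\<in>W \<inter> L. \<psi> (\<phi> x) = x)"
  shows "immersed_submanifold d S"
  unfolding immersed_submanifold_def
proof (intro exI[of _ "top_of_set S"] conjI ballI)
  show "topspace (top_of_set S) = S" by simp
  show "Hausdorff_space (top_of_set S)" by (intro Hausdorff_space_subtopology) simp
  show "second_countable (top_of_set S)" by (intro second_countable_subtopology second_countable_euclidean)
  show "continuous_map (top_of_set S) euclidean (\<lambda>x. x)" by (simp add: continuous_on_id)
  fix p assume p: "p \<in> S"
  then obtain L W and \<phi> \<psi> :: "'a \<Rightarrow> 'a" and U where *: "subspace L" "dim L = d" "smooth_on \<phi> W"
    "\<forall>x\<in>W \<inter> L. inj_on (frechet_derivative \<phi> (at x)) L" "open U" "p \<in> U" "\<phi> ` (W \<inter> L) = S \<inter> U"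
    "continuous_on U \<psi>" "\<forall>x\<in>W \<inter> L. \<psi> (\<phi> x) = x"
    using assms[OF p] by blast
  have cont: "continuous_on W \<phi>" using *(3) unfolding smooth_on_def by (metis Ck_on.simps(1))
  have "openin (top_of_set S) (\<phi> ` (W \<inter> L))" unfolding *(7) using *(5) by (simp add: openin_open_Int)
  moreover have "p \<in> \<phi> ` (W \<inter> L)" unfolding *(7) using p *(6) by blast
  moreover have "homeomorphic_map (top_of_set (W \<inter> L)) (subtopology (top_of_set S) (\<phi> ` (W \<inter> L))) \<phi>"
  proof -
    have sub: "subtopology (top_of_set S) (\<phi> ` (W \<inter> L)) = top_of_set (\<phi> ` (W \<inter> L))"
      unfolding subtopology_subtopology by (rule arg_cong) (use *(7) in blast)
    have "homeomorphic_maps (top_of_set (W \<inter> L)) (top_of_set (\<phi> ` (W \<inter> L))) \<phi> \<psi>"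
      unfolding homeomorphic_maps_def
    proof (intro conjI)
      show "continuous_map (top_of_set (W \<inter> L)) (top_of_set (\<phi> ` (W \<inter> L))) \<phi>"
        using cont by (simp add: continuous_on_subset image_subset_iff_funcset[symmetric])
      have "continuous_on (\<phi> ` (W \<inter> L)) \<psi>" using *(7,8) by (metis continuous_on_subset Int_lower2)
      then show "continuous_map (top_of_set (\<phi> ` (W \<inter> L))) (top_of_set (W \<inter> L)) \<psi>"
        using *(9) by (auto simp: image_subset_iff_funcset[symmetric])
    qed (use *(9) in auto)
    then show ?thesis unfolding sub homeomorphic_map_maps by blast
  qed
  ultimately show "\<exists>L W (\<phi> :: 'a \<Rightarrow> 'a). subspace L \<and> dim L = d \<and> smooth_on \<phi> W \<and>
      (\<forall>x\<in>W \<inter> L. inj_on (frechet_derivative \<phi> (at x)) L) \<and>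
      openin (top_of_set S) (\<phi> ` (W \<inter> L)) \<and> p \<in> \<phi> ` (W \<inter> L) \<and>
      homeomorphic_map (top_of_set (W \<inter> L)) (subtopology (top_of_set S) (\<phi> ` (W \<inter> L))) \<phi>"
    using *(1-4) by blast
qed

text \<open>In the coordinates \<open>(Y, X)\<close> with \<open>K = K\<^sub>0 + Y (I + X)\<^sup>-\<^sup>1\<close> the equation
  \<open>(F + G K) (I + X) = (I + X) A\<close> becomes the linear equation \<open>A X - X A + G Y = 0\<close>. A right inverse
  \<open>\<sigma>\<close> of \<open>X \<mapsto> A X - X A\<close> eliminates \<open>X = - \<sigma> (G Y)\<close>. Conversely, \<open>Y\<close> is recovered from \<open>K\<close> as
  \<open>(K - K\<^sub>0) P\<close>, where \<open>P\<close> solves the linear equation \<open>P + \<sigma> (G (K - K\<^sub>0) P) = I\<close>. That this \<open>P\<close>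
  intertwines \<open>A\<close> and \<open>F + G K\<close> follows by counting dimensions of spaces of intertwiners.\<close>

lemma feedback_set_chart:
  fixes F :: "real^'n^'n" and G :: "real^'m^'n" and K0 :: "real^'n^'m"
  assumes ctrb: "controllable F G" and K0: "K0 \<in> feedback_set F G \<alpha>"
  shows "\<exists>L W (\<phi> :: real^'n^'m \<Rightarrow> real^'n^'m) \<psi> U.
      subspace L \<and>
      int (dim L) = int CARD('n) * int CARD('m)
        - (\<Sum>k = 1..CARD('n). (2 * int k - 1) * int (degree (\<alpha> (CARD('n) - k + 1)))) \<and>
      smooth_on \<phi> W \<and> (\<forall>x\<in>W \<inter> L. inj_on (frechet_derivative \<phi> (at x)) L) \<and>
      open U \<and> K0 \<in> U \<and> \<phi> ` (W \<inter> L) = feedback_set F G \<alpha> \<inter> U \<and> continuous_on U \<psi> \<and>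
      (\<forall>x\<in>W \<inter> L. \<psi> (\<phi> x) = x)"
proof -
  let ?H = "feedback_set F G \<alpha>"
  define A where "A = F + G ** K0"
  define ad where "ad X = A ** X - X ** A" for X
  have A_inv: "has_invariant_polynomials A \<alpha>"
    using K0 by (simp add: A_def feedback_set_def similarity_class_def)
  have ad: "linear ad" unfolding ad_def
    by (intro linear_compose_sub linear_matrix_mult_left linear_matrix_mult_right)
  obtain \<sigma> where \<sigma>: "linear \<sigma>" "\<And>B. B \<in> range ad \<Longrightarrow> ad (\<sigma> B) = B"
    using linear_exists_right_inverse_on[OF ad subspace_UNIV] by blast
  have G_lin: "linear (\<lambda>Y. G ** (Y :: real^'n^'m))" by (rule linear_matrix_mult_left)
  \<comment> \<open>L consists of the Y for which the linear equation can be solved for X at all; it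
    is the model space.\<close>
  define L where "L = {Y. G ** Y \<in> range ad}"
  have sL: "subspace L"
    unfolding L_def using linear_subspace_vimage[OF G_lin linear_subspace_image[OF ad subspace_UNIV]]
    by (simp add: vimage_def)
  \<comment> \<open>Transversality gives dim (range G \<inter> range ad) = dim (range G) - dim (ker
    ad), where G acts on Y. Adding the dimension of its kernel, which lies in L, leaves n m - dim
    (ker ad).\<close>
  have dimL: "int (dim L) = int CARD('n) * int CARD('m) - int (dim {X. ad X = 0})"
  proof -
    let ?g = "\<lambda>Y :: real^'n^'m. G ** Y"
    have "dim {B + C |B C. B \<in> range ?g \<and> C \<in> range ad} + dim (range ?g \<inter> range ad)
        = dim (range ?g) + dim (range ad)"
      by (intro dim_sums_Int linear_subspace_image[OF G_lin] linear_subspace_image[OF ad] subspace_UNIV)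
    moreover have "{B + C |B C. B \<in> range ?g \<and> C \<in> range ad} = UNIV"
      unfolding ad_def by (rule controllable_transversal) (simp add: A_def controllable_feedback ctrb)
    moreover have "dim (range ad) + dim {X \<in> UNIV. ad X = 0} = dim (UNIV :: (real^'n^'n) set)"
      by (intro dim_image_plus_dim_kernel ad subspace_UNIV)
    moreover have "dim (range ?g) + dim {Y \<in> UNIV. ?g Y = 0} = dim (UNIV :: (real^'n^'m) set)"
      by (intro dim_image_plus_dim_kernel G_lin subspace_UNIV)
    moreover have "dim (?g ` L) + dim {Y \<in> L. ?g Y = 0} = dim L"
      by (intro dim_image_plus_dim_kernel G_lin sL)
    moreover have "?g ` L = range ?g \<inter> range ad" unfolding L_def by auto
    moreover have "{Y \<in> L. ?g Y = 0} = {Y \<in> UNIV. ?g Y = 0}"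
      unfolding L_def using linear_0[OF ad] by (auto intro: range_eqI[of _ _ 0])
    ultimately have "dim L + dim {X. ad X = 0} = DIM(real^'n^'m)" by simp
    then show ?thesis by (simp add: mult.commute flip: of_nat_mult of_nat_add)
  qed
  have ker0: "{X. ad X = 0} = {M. A ** M = M ** A}" unfolding ad_def by auto
  define \<eta> where "\<eta> Y = \<sigma> (G ** Y)" for Y
  have \<eta>: "bounded_linear \<eta>" unfolding \<eta>_def
    using linear_compose[unfolded o_def, OF G_lin \<sigma>(1)] by (simp add: linear_conv_bounded_linear)
  have \<eta>_lin: "linear \<eta>" using \<eta> by (rule bounded_linear.linear)
  obtain b where b: "b > 0" "\<And>v. norm (\<eta> v) \<le> norm v * b"
    using bounded_linear.pos_bounded[OF \<eta>] by blast
  obtain a where a: "a > 0" "\<And>(Z :: real^'n^'m) (M :: real^'n^'n). norm (Z ** M) \<le> norm Z * norm M * a"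
    using bounded_bilinear.pos_bounded[OF bounded_bilinear_matrix_mult] by blast
  define c where "c = a * b"
  have c: "c > 0" using a b by (simp add: c_def)
  have \<eta>_bound: "norm (\<eta> (Z ** M)) \<le> norm Z * norm M * c"
    for Z :: "real^'n^'m" and M :: "real^'n^'n"
  proof -
    have "norm (\<eta> (Z ** M)) \<le> norm (Z ** M) * b" by (rule b)
    also have "\<dots> \<le> (norm Z * norm M * a) * b" using a(2) b(1) by (intro mult_right_mono) auto
    finally show ?thesis by (simp add: c_def mult_ac)
  qed
  define \<Lambda> where "\<Lambda> K M = M + \<eta> ((K - K0) ** M)" for K M
  have \<Lambda>: "linear (\<Lambda> K)" for K
    unfolding \<Lambda>_def
    by (intro linear_compose_add linear_ident linear_compose[unfolded o_def, OF linear_matrix_mult_left \<eta>_lin])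
  \<comment> \<open>With this radius the perturbation in \<Lambda> has norm at most half that of M,
    so \<Lambda> is injective with an explicit lower bound.\<close>
  define U0 where "U0 = ball K0 (1 / (2 * c))"
  have \<Lambda>_lower: "norm M \<le> 2 * norm (\<Lambda> K M)" if "K \<in> U0" for K M
  proof -
    have "norm (K - K0) * c \<le> 1 / 2"
      using that c by (simp add: U0_def dist_norm norm_minus_commute field_simps)
    then have "norm M * (norm (K - K0) * c) \<le> norm M * (1 / 2)" by (rule mult_left_mono) simp
    then have "norm (\<eta> ((K - K0) ** M)) \<le> norm M * (1 / 2)"
      using \<eta>_bound[of "K - K0" M] by (simp add: mult_ac)
    moreover have "norm M \<le> norm (\<Lambda> K M) + norm (\<eta> ((K - K0) ** M))"
      unfolding \<Lambda>_def by (metis add_diff_cancel_right' norm_triangle_ineq4)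
    ultimately show ?thesis by simp
  qed
  have \<Lambda>_0: "M = 0" if "K \<in> U0" "\<Lambda> K M = 0" for K M
    using \<Lambda>_lower[OF that(1), of M] that(2) by simp
  have \<Lambda>_inj: "M = M'" if "K \<in> U0" "\<Lambda> K M = \<Lambda> K M'" for K M M'
    using \<Lambda>_0[OF that(1), of "M - M'"] that(2) by (simp add: linear_diff[OF \<Lambda>])
  define P where "P K = (SOME M. \<Lambda> K M = mat 1)" for K
  have P: "\<Lambda> K (P K) = mat 1" if "K \<in> U0" for K
  proof -
    have "inj (\<Lambda> K)" using \<Lambda>_inj[OF that] by (auto intro: injI)
    then have "surj (\<Lambda> K)" using linear_inj_imp_surj[OF \<Lambda>] by blast
    then have "\<exists>M. \<Lambda> K M = mat 1" by (metis surjD)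
    then show ?thesis unfolding P_def by (rule someI_ex)
  qed
  have P_eqI: "P K = M" if "K \<in> U0" "\<Lambda> K M = mat 1" for K M
    using \<Lambda>_inj[OF that(1), of "P K" M] P[OF that(1)] that(2) by simp
  \<comment> \<open>Subtracting the defining equations of \<open>P K\<close> and \<open>P K'\<close>
    gives \<open>\<Lambda> K (P K - P K') = \<eta> ((K' - K) ** P K')\<close>; the lower bound for
    \<Lambda> turns this into a Lipschitz estimate.\<close>
  have P_cont: "continuous_on U0 P"
  proof (rule lipschitz_on_continuous_on, rule lipschitz_onI)
    fix K K' assume K: "K \<in> U0" "K' \<in> U0"
    have "\<Lambda> K (P K - P K') = \<Lambda> K' (P K') - \<Lambda> K (P K')" using P K by (simp add: linear_diff[OF \<Lambda>])
    also have "\<dots> = \<eta> ((K' - K0) ** P K' - (K - K0) ** P K')"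
      unfolding \<Lambda>_def linear_diff[OF \<eta>_lin] by simp
    also have "(K' - K0) ** P K' - (K - K0) ** P K' = (K' - K) ** P K'"
      unfolding matrix_diff_rdistrib[symmetric] by simp
    finally have "norm (P K - P K') \<le> 2 * norm (\<eta> ((K' - K) ** P K'))"
      using \<Lambda>_lower[OF K(1), of "P K - P K'"] by simp
    also have "\<dots> \<le> 2 * (norm (K' - K) * norm (P K') * c)" using \<eta>_bound by simp
    also have "\<dots> \<le> 2 * (norm (K' - K) * (2 * norm (mat 1 :: real^'n^'n)) * c)"
      using \<Lambda>_lower[OF K(2), of "P K'"] P[OF K(2)] c
      by (intro mult_left_mono mult_right_mono) auto
    finally show "dist (P K) (P K') \<le> (4 * norm (mat 1 :: real^'n^'n) * c) * dist K K'"
      by (simp add: dist_norm norm_minus_commute mult_ac)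
  qed (use c in simp)
  \<comment> \<open>In the coordinates of K the matrix I - \<eta> Y will turn out to be
    \<open>P K\<close>, which must be invertible for \<phi> to apply.\<close>
  define U where "U = {K \<in> U0. det (P K) \<noteq> 0}"
  have U: "open U" unfolding U_def using open_det_nonzero[OF P_cont] by (simp add: U0_def)
  have "K0 \<in> U0" using c by (simp add: U0_def)
  moreover from this have "P K0 = mat 1" by (rule P_eqI) (simp add: \<Lambda>_def linear_0[OF \<eta>_lin])
  ultimately have K0_U: "K0 \<in> U" by (simp add: U_def)
  define W1 where "W1 = {Y \<in> UNIV. det (mat 1 - \<eta> Y) \<noteq> 0}"
  have W1: "open W1" unfolding W1_def
    by (intro open_det_nonzero continuous_intros bounded_linear.continuous_on[OF \<eta>] open_UNIV)
  define N where "N Y = matrix_inv (mat 1 - \<eta> Y)" for Y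
  have N: "(mat 1 - \<eta> Y) ** N Y = mat 1" "N Y ** (mat 1 - \<eta> Y) = mat 1" if "Y \<in> W1" for Y
    using that matrix_inv_mult[of "mat 1 - \<eta> Y"] by (simp_all add: W1_def N_def)
  have N_cont: "continuous_on W1 N" by (rule resolvent_continuous[OF \<eta> W1 N(1)])
  define \<phi> where "\<phi> Y = K0 + Y ** N Y" for Y
  have \<phi>_cont: "continuous_on W1 \<phi>" unfolding \<phi>_def
    by (intro continuous_intros bounded_bilinear.continuous_on[OF bounded_bilinear_matrix_mult] N_cont)
  define W where "W = W1 \<inter> \<phi> -` U"
  have W: "open W" unfolding W_def by (rule continuous_open_preimage[OF \<phi>_cont W1 U])
  have smooth: "smooth_on \<phi> W"
    unfolding smooth_on_def \<phi>_def
  proof (intro conjI W allI)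
    fix k
    have "Ck_on k N W" by (rule Ck_on_resolvent[OF \<eta> W N(1)]) (simp add: W_def)
    then show "Ck_on k (\<lambda>Y. K0 + Y ** N Y) W"
      by (intro Ck_on_add[OF W] Ck_on_const Ck_on_bilinear[OF W bounded_bilinear_matrix_mult]
          Ck_on_bounded_linear[OF W bounded_linear_ident])
  qed
  have closed_loop: "F + G ** K = A + G ** (K - K0)" for K
    by (simp add: A_def matrix_diff_ldistrib)
  have intertwiner_iff: "(F + G ** K) ** M = M ** A \<longleftrightarrow> ad M = - (G ** ((K - K0) ** M))" for K M
    unfolding closed_loop ad_def by (simp add: matrix_add_rdistrib matrix_mul_assoc) (auto simp: algebra_simps)
  have \<Lambda>_intertwiner: "\<Lambda> K M = M - \<sigma> (ad M)" if "ad M = - (G ** ((K - K0) ** M))" for K M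
    unfolding that \<Lambda>_def \<eta>_def by (simp add: linear_neg[OF \<sigma>(1)])
  \<comment> \<open>On intertwiners \<open>\<Lambda> K M\<close> is M - \<sigma> (ad M), which ad
    annihilates. So \<Lambda> K embeds the intertwiners into the centralizer of A, and equal
    dimensions make it onto. The identity commutes with A, hence has an intertwiner as preimage, and
    by uniqueness this is \<open>P K\<close>.\<close>
  have P_intertwines: "ad (P K) = - (G ** ((K - K0) ** P K))" if K: "K \<in> U0" "K \<in> ?H" for K
  proof -
    let ?S = "{M. (F + G ** K) ** M = M ** A}"
    have lin_S: "linear (\<lambda>M. (F + G ** K) ** M - M ** A)"
      by (intro linear_compose_sub linear_matrix_mult_left linear_matrix_mult_right)
    have sub: "subspace ?S" using linear_subspace_kernel[OF lin_S] by simp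
    have "has_invariant_polynomials (F + G ** K) \<alpha>"
      using K(2) by (simp add: feedback_set_def similarity_class_def)
    then have "int (dim ?S) = int (dim {M. A ** M = M ** A})"
      using A_inv by (simp only: dim_intertwiners_invariant_polynomials)
    moreover have "inj_on (\<Lambda> K) (span ?S)" using \<Lambda>_inj[OF K(1)] by (auto intro: inj_onI)
    ultimately have "dim (\<Lambda> K ` ?S) = dim {X. ad X = 0}" 
      using dim_image_eq[OF \<Lambda>, of K ?S] unfolding ker0 by simp
    moreover have "\<Lambda> K ` ?S \<subseteq> {X. ad X = 0}"
    proof clarify
      fix M assume "(F + G ** K) ** M = M ** A"
      then have "\<Lambda> K M = M - \<sigma> (ad M)" unfolding intertwiner_iff by (rule \<Lambda>_intertwiner)
      then show "ad (\<Lambda> K M) = 0" using \<sigma>(2)[of "ad M"] by (simp add: linear_diff[OF ad])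
    qed
    ultimately have "\<Lambda> K ` ?S = {X. ad X = 0}"
      using subspace_dim_equal[OF linear_subspace_image[OF \<Lambda> sub] linear_subspace_kernel[OF ad]] by simp
    moreover have "ad (mat 1) = 0" by (simp add: ad_def)
    ultimately obtain M where M: "M \<in> ?S" "\<Lambda> K M = mat 1" by (metis (mono_tags, lifting) imageE mem_Collect_eq)
    then have "P K = M" using P_eqI K(1) by blast
    then show ?thesis using M(1) unfolding intertwiner_iff by simp
  qed
  define \<psi> where "\<psi> K = (K - K0) ** P K" for K
  have \<psi>_cont: "continuous_on U \<psi>" unfolding \<psi>_def
    using continuous_on_subset[OF P_cont, of U]
    by (intro bounded_bilinear.continuous_on[OF bounded_bilinear_matrix_mult] continuous_intros) (auto simp: U_def)
  have fwd: "\<phi> Y \<in> ?H \<inter> U \<and> \<psi> (\<phi> Y) = Y \<and> (\<phi> Y - K0) ** (mat 1 - \<eta> Y) = Y" if Y: "Y \<in> W \<inter> L" for Y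
  proof -
    let ?R = "mat 1 - \<eta> Y"
    have Y1: "Y \<in> W1" "\<phi> Y \<in> U" "\<phi> Y \<in> U0" using Y by (auto simp: W_def U_def)
    have diff: "(\<phi> Y - K0) ** ?R = Y"
    proof -
      have "(\<phi> Y - K0) ** ?R = Y ** (N Y ** ?R)" by (simp add: \<phi>_def matrix_mul_assoc)
      then show ?thesis using N(2)[OF Y1(1)] by simp
    qed
    have "ad ?R = - (G ** Y)"
      using Y \<sigma>(2) unfolding L_def \<eta>_def by (simp add: linear_diff[OF ad]) (simp add: ad_def)
    then have ad_R: "ad ?R = - (G ** ((\<phi> Y - K0) ** ?R))" unfolding diff .
    then have RA: "(F + G ** \<phi> Y) ** ?R = ?R ** A" unfolding intertwiner_iff .
    have "F + G ** \<phi> Y = (F + G ** \<phi> Y) ** ?R ** N Y"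
      using N(1)[OF Y1(1)] by (simp add: matrix_mul_assoc[symmetric])
    then have "F + G ** \<phi> Y = ?R ** A ** N Y" unfolding RA .
    then have "\<phi> Y \<in> ?H"
      using has_invariant_polynomials_similar[OF A_inv N(1)[OF Y1(1)]]
      by (simp add: feedback_set_def similarity_class_def)
    moreover have "\<Lambda> (\<phi> Y) ?R = mat 1" unfolding \<Lambda>_def diff by simp
    then have "P (\<phi> Y) = ?R" using P_eqI Y1(3) by blast
    then have "\<psi> (\<phi> Y) = Y" using diff by (simp add: \<psi>_def)
    ultimately show ?thesis using diff Y1(2) by blast
  qed
  have bwd: "K \<in> \<phi> ` (W \<inter> L)" if K: "K \<in> ?H \<inter> U" for K
  proof -
    have K_U0: "K \<in> U0" using K by (simp add: U_def)
    define Y where "Y = \<psi> K"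
    have adP: "ad (P K) = - (G ** Y)"
      unfolding Y_def \<psi>_def by (rule P_intertwines) (use K K_U0 in auto)
    then have "G ** Y = ad (- P K)" by (simp add: linear_neg[OF ad])
    then have YL: "Y \<in> L" by (simp add: L_def)
    have R: "mat 1 - \<eta> Y = P K"
      using P[OF K_U0] unfolding \<Lambda>_def Y_def \<psi>_def by (simp add: algebra_simps)
    have Y1: "Y \<in> W1" using K by (simp add: W1_def R U_def)
    have "Y ** N Y = (K - K0) ** ((mat 1 - \<eta> Y) ** N Y)"
      unfolding R by (simp add: Y_def \<psi>_def matrix_mul_assoc)
    then have "\<phi> Y = K" using N(1)[OF Y1] by (simp add: \<phi>_def)
    then show ?thesis using Y1 YL K by (auto simp: W_def image_iff intro!: bexI[of _ Y])
  qed
  have immersion: "inj_on (frechet_derivative \<phi> (at Y)) L" if Y: "Y \<in> W \<inter> L" for Y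
  proof -
    have Y1: "Y \<in> W1" "\<phi> Y \<in> U0" using Y by (auto simp: W_def U_def)
    let ?d = "\<lambda>v. Y ** (N Y ** \<eta> v ** N Y) + v ** N Y"
    have "((\<lambda>Y. K0 + Y ** N Y) has_derivative (\<lambda>v. 0 + ?d v)) (at Y)"
      by (intro has_derivative_add has_derivative_const has_derivative_ident
          bounded_bilinear.FDERIV[OF bounded_bilinear_matrix_mult] resolvent_derivative[OF \<eta> W1 N(1) Y1(1)])
    then have der: "(\<phi> has_derivative ?d) (at Y)" unfolding \<phi>_def by simp
    have "v = 0" if v: "v \<in> L" "?d v = 0" for v
    proof -
      \<comment> \<open>Multiplying by I - \<eta> Y removes the trailing inverse and leaves
        \<open>(\<phi> Y - K0) ** \<eta> v = - v\<close>. Then \<Lambda> at \<open>\<phi> Y\<close>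
        kills \<eta> v, so \<eta> v = 0 and v = 0.\<close>
      have "?d v ** (mat 1 - \<eta> Y) = Y ** N Y ** \<eta> v ** (N Y ** (mat 1 - \<eta> Y)) + v ** (N Y ** (mat 1 - \<eta> Y))"
        by (simp only: matrix_add_rdistrib matrix_mul_assoc)
      then have "Y ** N Y ** \<eta> v + v = 0" using v(2) N(2)[OF Y1(1)] by simp
      then have v_eq: "(\<phi> Y - K0) ** \<eta> v = - v" by (simp add: \<phi>_def eq_neg_iff_add_eq_0)
      have "\<Lambda> (\<phi> Y) (\<eta> v) = 0" unfolding \<Lambda>_def v_eq by (simp add: linear_neg[OF \<eta>_lin])
      then have "\<eta> v = 0" using \<Lambda>_0 Y1(2) by blast
      then show "v = 0" using v_eq by simp
    qed
    then have "inj_on ?d L"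
      using linear_inj_on_iff_eq_0[OF has_derivative_linear[OF der] sL] by blast
    then show ?thesis using frechet_derivative_at[OF der] by simp
  qed
  have "int (dim {X. ad X = 0}) = (\<Sum>k = 1..CARD('n). (2 * int k - 1) * int (degree (\<alpha> (CARD('n) - k + 1))))"
    unfolding ker0 by (rule dim_intertwiners_invariant_polynomials[OF A_inv A_inv])
  then have "int (dim L) = int CARD('n) * int CARD('m)
      - (\<Sum>k = 1..CARD('n). (2 * int k - 1) * int (degree (\<alpha> (CARD('n) - k + 1))))"
    using dimL by simp
  moreover have "\<phi> ` (W \<inter> L) = ?H \<inter> U" using fwd bwd by blast
  ultimately show ?thesis
    using sL smooth immersion U K0_U \<psi>_cont fwd by blast
qed

theorem theorem3p2:
  fixes F :: "real^'n^'n" and G :: "real^'m^'n" and \<alpha> :: "nat \<Rightarrow> real poly"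
  assumes "controllable F G"
    and "\<And>i. i \<in> {1..CARD('n)} \<Longrightarrow> lead_coeff (\<alpha> i) = 1"
    and "\<And>i. i \<in> {1..<CARD('n)} \<Longrightarrow> \<alpha> i dvd \<alpha> (Suc i)"
    and "majorized (map (ctrb_index F G) [1..<CARD('m) + 1])
           (map (\<lambda>k. degree (\<alpha> (CARD('n) - k + 1))) [1..<CARD('n) + 1])"
  shows "feedback_set F G \<alpha> \<noteq> {} \<and>
    (\<exists>d. immersed_submanifold d (feedback_set F G \<alpha>) \<and>
      int d = int CARD('n) * int CARD('m)
        - (\<Sum>k = 1..CARD('n). (2 * int k - 1) * int (degree (\<alpha> (CARD('n) - k + 1)))))"
proof
  show nonempty: "feedback_set F G \<alpha> \<noteq> {}" using assms by (rule feedback_set_nonempty)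
  define D where "D = int CARD('n) * int CARD('m)
        - (\<Sum>k = 1..CARD('n). (2 * int k - 1) * int (degree (\<alpha> (CARD('n) - k + 1))))"
  \<comment> \<open>The integer D could a priori be negative. A chart at one point of the nonempty
    set exhibits it as the dimension of a subspace, so it is a natural number d.\<close>
  obtain K where "K \<in> feedback_set F G \<alpha>" using nonempty by blast
  from feedback_set_chart[OF assms(1) this] obtain d where d: "int d = D"
    unfolding D_def[symmetric] by (elim exE conjE) (rule that)
  have "immersed_submanifold d (feedback_set F G \<alpha>)"
    by (rule immersed_submanifoldI)
      (rule feedback_set_chart[OF assms(1), of _ \<alpha>, folded D_def, folded d, unfolded of_nat_eq_iff])
  then show "\<exists>d. immersed_submanifold d (feedback_set F G \<alpha>) \<and>
      int d = int CARD('n) * int CARD('m)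
        - (\<Sum>k = 1..CARD('n). (2 * int k - 1) * int (degree (\<alpha> (CARD('n) - k + 1))))"
    using d unfolding D_def by blast
qed

end
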